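(* Let $s$ be a primitive string over $\Sigma=\{c_1,\dots,c_\sigma\}$. Given $BWT_*(s)$ with constant time rank support, the permutations $\{\pi_x\}$ used to build the matrix $M_*(s)$, and the row index $i$ containing $s$ in $M_*(s)$, the original string $s$ can be recovered in $\mathcal{O}(\sigma|s|^2)$ time and $\mathcal{O}(\sigma|s|)$ working space.
   Context: A string is primitive if all its cyclic rotations are distinct. A context adaptive BWT: for every string $x$ an ordering (permutation) $\pi_x$ of $\Sigma$ is fixed; the matrix $M_*(s)$ has as rows all cyclic rotations of $s$, sorted so that, for two distinct rotations whose longest common prefix is $x$, the one whose $(|x|+1)$-st symbol is smaller according to $\pi_x$ comes first; $BWT_*(s)$ is the last column of $M_*(s)$. Constant time rank support means $\mathrm{rank}_c(BWT_*(s),j)$ (number of occurrences of $c$ among the first $j$ symbols) is answered in $\mathcal{O}(1)$ time. Computation model: word RAM with word size $w$, $\sigma=w^{\mathcal{O}(1)}$; space measured in words. *)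

theory Defs
  imports Complex_Main "HOL-Library.Multiset" "HOL-Library.Sublist" "HOL-Combinatorics.Permutations"
begin

section \<open>Context adaptive Burrows-Wheeler transforms\<close>

text \<open>The symbols \<open>c\<^sub>1, \<dots>, c\<^sub>\<sigma>\<close> are the numbers \<open>0, \<dots>, \<sigma> - 1\<close>, so that a symbol is a
  machine word.  A family of orderings is a function \<open>\<pi>\<close> such that \<open>\<pi> x c\<close> is the position (from 0)
  of the symbol \<open>c\<close> in the ordering \<open>\<pi>\<^sub>x\<close>.\<close>

type_synonym orderings = "nat list \<Rightarrow> nat \<Rightarrow> nat"

definition orderings_on :: "nat \<Rightarrow> orderings \<Rightarrow> bool" where
  "orderings_on \<sigma> \<pi> \<longleftrightarrow> (\<forall>x. set x \<subseteq> {..<\<sigma>} \<longrightarrow> \<pi> x permutes {..<\<sigma>})"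

definition rotations :: "'a list \<Rightarrow> 'a list list" where
  "rotations s = map (\<lambda>k. rotate k s) [0..<length s]"

definition primitive :: "'a list \<Rightarrow> bool" where
  "primitive s \<longleftrightarrow> distinct (rotations s)"

definition ctx_less :: "orderings \<Rightarrow> nat list \<Rightarrow> nat list \<Rightarrow> bool" where
  "ctx_less \<pi> u v \<longleftrightarrow> u \<noteq> v \<and>
     (let x = longest_common_prefix u v in \<pi> x (u ! length x) < \<pi> x (v ! length x))"

definition ctx_matrix :: "orderings \<Rightarrow> nat list \<Rightarrow> nat list list" where
  "ctx_matrix \<pi> s =
     (THE M. mset M = mset (rotations s) \<and> sorted_wrt (\<lambda>u v. u = v \<or> ctx_less \<pi> u v) M)"

definition ctx_bwt :: "orderings \<Rightarrow> nat list \<Rightarrow> nat list" where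
  "ctx_bwt \<pi> s = map last (ctx_matrix \<pi> s)"

definition rank :: "'a list \<Rightarrow> 'a \<Rightarrow> nat \<Rightarrow> nat" where
  "rank b c j = count_list (take j b) c"


subsection \<open>The matrix is well defined\<close>

lemma ctx_less_Cons:
  "ctx_less \<pi> (a # u) (b # v) \<longleftrightarrow>
     (if a = b then ctx_less (\<lambda>x. \<pi> (a # x)) u v else \<pi> [] a < \<pi> [] b)"
  by (auto simp: ctx_less_def Let_def)

lemma orderings_on_Cons:
  "orderings_on \<sigma> \<pi> \<Longrightarrow> a < \<sigma> \<Longrightarrow> orderings_on \<sigma> (\<lambda>x. \<pi> (a # x))"
  by (auto simp: orderings_on_def)

lemma orderings_on_inj:
  "orderings_on \<sigma> \<pi> \<Longrightarrow> \<pi> [] a = \<pi> [] b \<Longrightarrow> a = b"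
  by (auto simp: orderings_on_def dest!: spec[of _ "[]"] permutes_inj injD)

lemma ctx_less_total:
  assumes "length u = length v" "orderings_on \<sigma> \<pi>" "set u \<subseteq> {..<\<sigma>}" "set v \<subseteq> {..<\<sigma>}"
  shows "u = v \<or> ctx_less \<pi> u v \<or> ctx_less \<pi> v u"
  using assms
proof (induction u v arbitrary: \<pi> rule: list_induct2)
  case (Cons a u b v)
  then show ?case
    using Cons.IH[of "\<lambda>x. \<pi> (a # x)"] orderings_on_Cons[of \<sigma> \<pi> a] orderings_on_inj[of \<sigma> \<pi> a b]
    by (cases "\<pi> [] a" "\<pi> [] b" rule: linorder_cases) (auto simp: ctx_less_Cons)
qed simp

lemma ctx_less_trans:
  assumes "length u = length v" "length v = length z" "ctx_less \<pi> u v" "ctx_less \<pi> v z"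
  shows "ctx_less \<pi> u z"
  using assms
proof (induction u v z arbitrary: \<pi> rule: list_induct3)
  case (Cons a u b v c z)
  then show ?case
    by (auto simp: ctx_less_Cons split: if_splits)
qed (simp add: ctx_less_def)

lemma ctx_less_asym: "ctx_less \<pi> u v \<Longrightarrow> \<not> ctx_less \<pi> v u"
proof -
  have "longest_common_prefix u v = longest_common_prefix v u"
    by (induction u v rule: longest_common_prefix.induct) auto
  then show "ctx_less \<pi> u v \<Longrightarrow> \<not> ctx_less \<pi> v u"
    by (auto simp: ctx_less_def Let_def)
qed

lemma sorted_wrt_exists:
  assumes "\<And>x y. x \<in> A \<Longrightarrow> y \<in> A \<Longrightarrow> R x y \<or> R y x"
    and "\<And>x y z. x \<in> A \<Longrightarrow> y \<in> A \<Longrightarrow> z \<in> A \<Longrightarrow> R x y \<Longrightarrow> R y z \<Longrightarrow> R x z"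
    and "set xs \<subseteq> A"
  shows "\<exists>ys. mset ys = mset xs \<and> sorted_wrt R ys"
  using assms(3)
proof (induction xs)
  case (Cons a xs)
  then obtain ys where ys: "mset ys = mset xs" "sorted_wrt R ys" by auto
  have A: "a \<in> A" "set ys \<subseteq> A" using Cons.prems ys(1) mset_eq_setD by fastforce+
  let ?zs = "filter (\<lambda>y. \<not> R a y) ys @ a # filter (R a) ys"
  have "R y z" if "y \<in> set ys" "\<not> R a y" "z \<in> set ys" "R a z" for y z
    using assms(1)[of a y] assms(2)[of y a z] A that by blast
  moreover have "R y a" if "y \<in> set ys" "\<not> R a y" for y
    using assms(1)[of a y] A that by blast
  ultimately have "sorted_wrt R ?zs"
    using ys(2) by (auto simp: sorted_wrt_append sorted_wrt_filter)
  moreover have "mset ?zs = mset (a # xs)"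
    using ys(1) by (simp add: add.commute flip: multiset_partition)
  ultimately show ?case by blast
qed simp

lemma sorted_wrt_unique:
  assumes "\<And>x y. R x y \<Longrightarrow> R y x \<Longrightarrow> x = y"
    and "mset xs = mset ys" "sorted_wrt R xs" "sorted_wrt R ys"
  shows "xs = ys"
  using assms(2-)
proof (induction xs arbitrary: ys)
  case (Cons a xs)
  then obtain b zs where ys: "ys = b # zs" by (cases ys) auto
  have "a \<in> set ys" "b \<in> set (a # xs)"
    using mset_eq_setD[OF Cons.prems(1)] ys by auto
  then have "a = b" using Cons.prems(2,3) assms(1)[of a b] ys by auto
  then show ?case using Cons ys by auto
qed simp

lemma ctx_matrix:
  assumes "orderings_on \<sigma> \<pi>" "set s \<subseteq> {..<\<sigma>}"
  shows "mset (ctx_matrix \<pi> s) = mset (rotations s)"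
    and "sorted_wrt (\<lambda>u v. u = v \<or> ctx_less \<pi> u v) (ctx_matrix \<pi> s)"
proof -
  let ?R = "\<lambda>u v. u = v \<or> ctx_less \<pi> u v"
  let ?A = "{u. length u = length s \<and> set u \<subseteq> {..<\<sigma>}}"
  have "\<exists>M. mset M = mset (rotations s) \<and> sorted_wrt ?R M"
  proof (rule sorted_wrt_exists[where A = ?A])
    show "?R u v \<or> ?R v u" if "u \<in> ?A" "v \<in> ?A" for u v
      using that ctx_less_total[OF _ assms(1), of u v] by auto
    show "?R u z" if "u \<in> ?A" "v \<in> ?A" "z \<in> ?A" "?R u v" "?R v z" for u v z
      using that ctx_less_trans[of u v z \<pi>] by auto
    show "set (rotations s) \<subseteq> ?A"
      using assms(2) by (auto simp: rotations_def)
  qed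
  then have "\<exists>!M. mset M = mset (rotations s) \<and> sorted_wrt ?R M"
    by (rule ex_ex1I) (rule sorted_wrt_unique[where R = ?R], use ctx_less_asym in auto)
  from theI'[OF this]
  show "mset (ctx_matrix \<pi> s) = mset (rotations s)" "sorted_wrt ?R (ctx_matrix \<pi> s)"
    unfolding ctx_matrix_def by auto
qed


section \<open>The word RAM\<close>

text \<open>A machine with word size \<open>w\<close> has finitely many registers (those named in the program, hence a
  number that does not depend on the input) and a memory of \<open>m\<close> words with addresses
  \<open>0, \<dots>, m - 1\<close>.  All results are reduced modulo \<open>2 ^ w\<close>, so that a word
  can address the whole memory only if \<open>m \<le> 2 ^ w\<close>.

  The BWT and the orderings are read-only and can only be accessed by the instructions \<open>Bwt\<close>,
  \<open>Rank\<close> and \<open>Order\<close>; they are not part of the memory.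
  \<open>Order d a l c\<close> evaluates \<open>\<pi>\<^sub>x\<close> at the symbol in register \<open>c\<close>; the string \<open>x\<close> has to be spelled out
  in memory, starting at the address in register \<open>a\<close>, with its length in register \<open>l\<close>.  It costs
  \<open>1 + |x|\<close>; every other instruction, and every test, costs 1.\<close>

type_synonym reg = nat

datatype binop = Add | Sub | Mul | Div | Mod | And | Or | Xor | Shl | Shr | Eq | Less

fun eval_binop :: "nat \<Rightarrow> binop \<Rightarrow> nat \<Rightarrow> nat \<Rightarrow> nat" where
  "eval_binop w Add x y = x + y"
| "eval_binop w Sub x y = x + 2 ^ w - y"
| "eval_binop w Mul x y = x * y"
| "eval_binop w Div x y = x div y"
| "eval_binop w Mod x y = x mod y"
| "eval_binop w And x y = and x y"
| "eval_binop w Or x y = or x y"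
| "eval_binop w Xor x y = xor x y"
| "eval_binop w Shl x y = push_bit y x"
| "eval_binop w Shr x y = drop_bit y x"
| "eval_binop w Eq x y = of_bool (x = y)"
| "eval_binop w Less x y = of_bool (x < y)"

datatype prog =
    Const reg nat
  | Op binop reg reg reg
  | Load reg reg
  | Store reg reg
  | Bwt reg reg
  | Rank reg reg reg
  | Order reg reg reg reg
  | Seq prog prog
  | IfNZ reg prog prog
  | WhileNZ reg prog

type_synonym state = "(reg \<Rightarrow> nat) \<times> (nat \<Rightarrow> nat)"

text \<open>\<open>exec w m b \<pi> P st t st'\<close>: with word size \<open>w\<close>, \<open>m\<close> words of memory, BWT \<open>b\<close> and orderings
  \<open>\<pi>\<close>, the program \<open>P\<close> started in \<open>st\<close> halts in \<open>st'\<close> after time \<open>t\<close>.  There is no execution if an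
  address outside the memory is accessed.\<close>

inductive exec :: "nat \<Rightarrow> nat \<Rightarrow> nat list \<Rightarrow> orderings \<Rightarrow> prog \<Rightarrow> state \<Rightarrow> nat \<Rightarrow> state \<Rightarrow> bool"
  for w m :: nat and b :: "nat list" and \<pi> :: orderings where
  Const: "exec w m b \<pi> (Const d k) (r, M) 1 (r(d := k mod 2 ^ w), M)"
| Op: "exec w m b \<pi> (Op f d x y) (r, M) 1 (r(d := eval_binop w f (r x) (r y) mod 2 ^ w), M)"
| Load: "r a < m \<Longrightarrow> exec w m b \<pi> (Load d a) (r, M) 1 (r(d := M (r a)), M)"
| Store: "r a < m \<Longrightarrow> exec w m b \<pi> (Store a x) (r, M) 1 (r, M(r a := r x))"
| Bwt: "r j < length b \<Longrightarrow> exec w m b \<pi> (Bwt d j) (r, M) 1 (r(d := b ! r j mod 2 ^ w), M)"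
| Rank: "r j \<le> length b \<Longrightarrow>
    exec w m b \<pi> (Rank d c j) (r, M) 1 (r(d := rank b (r c) (r j) mod 2 ^ w), M)"
| Order: "r a + r l \<le> m \<Longrightarrow>
    exec w m b \<pi> (Order d a l c) (r, M) (1 + r l)
      (r(d := \<pi> (map M [r a..<r a + r l]) (r c) mod 2 ^ w), M)"
| Seq: "exec w m b \<pi> P st t st' \<Longrightarrow> exec w m b \<pi> Q st' t' st'' \<Longrightarrow>
    exec w m b \<pi> (Seq P Q) st (t + t') st''"
| IfTrue: "r x \<noteq> 0 \<Longrightarrow> exec w m b \<pi> P (r, M) t st' \<Longrightarrow> exec w m b \<pi> (IfNZ x P Q) (r, M) (1 + t) st'"
| IfFalse: "r x = 0 \<Longrightarrow> exec w m b \<pi> Q (r, M) t st' \<Longrightarrow> exec w m b \<pi> (IfNZ x P Q) (r, M) (1 + t) st'"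
| WhileTrue: "r x \<noteq> 0 \<Longrightarrow> exec w m b \<pi> P (r, M) t st' \<Longrightarrow> exec w m b \<pi> (WhileNZ x P) st' t' st'' \<Longrightarrow>
    exec w m b \<pi> (WhileNZ x P) (r, M) (1 + t + t') st''"
| WhileFalse: "r x = 0 \<Longrightarrow> exec w m b \<pi> (WhileNZ x P) (r, M) 1 (r, M)"

text \<open>The scalar inputs are passed in registers \<open>0, 1, \<dots>\<close>; everything else is initially 0.  The
  output is read from the beginning of the memory.\<close>

definition initial_state :: "nat list \<Rightarrow> state" where
  "initial_state xs = ((\<lambda>k. if k < length xs then xs ! k else 0), \<lambda>_. 0)"

definition computes :: "nat \<Rightarrow> nat \<Rightarrow> nat list \<Rightarrow> orderings \<Rightarrow> prog \<Rightarrow> nat list \<Rightarrow> nat \<Rightarrow> nat list \<Rightarrow> bool"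
  where "computes w m b \<pi> P xs t ys \<longleftrightarrow>
    length ys \<le> m \<and>
    (\<exists>r M. exec w m b \<pi> P (initial_state xs) t (r, M) \<and> map M [0..<length ys] = ys)"

end

theory Submission
  imports Defs
begin

text \<open>A word \<open>x\<close> is branching if two rows of the matrix share the prefix \<open>x\<close> and then differ; adjacent
  rows with longest common prefix \<open>x\<close> witness this, so there are fewer than \<open>|s|\<close> branching words.
  If \<open>ay\<close> is branching then so is \<open>y\<close>, and the number of rows starting with \<open>ayc\<close> is the number of
  occurrences of \<open>a\<close> in the part of the BWT that belongs to the rows starting with \<open>yc\<close>.  A
  breadth-first search over left extensions therefore visits all branching words; for each word
  it evaluates \<open>\<pi>\<close> once per symbol and lays out the row intervals of its one-symbol
  extensions, at a cost of \<open>O(\<sigma>|s|)\<close> per word.  Only the branching words are affordable: evaluating \<open>\<pi>\<close>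
  at every substring would cost \<open>\<sigma>|s|\<^sup>3\<close>.

  Along the way an array holds, for each row \<open>p\<close>, the first row of the block in which the
  cyclic predecessor of row \<open>p\<close> is currently known to lie.  When \<open>ay\<close> is discovered at a row \<open>p\<close>, this
  entry is exactly the first row starting with \<open>ay\<close>.  In the end all blocks are
  singletons because \<open>s\<close> is primitive, and \<open>s\<close> is read off backwards from row \<open>i\<close>.\<close>

section \<open>Rows and branching words\<close>

text \<open>In the ordinary BWT the rows starting with \<open>a\<close> keep the relative order of
  the rows they precede, so one rank query yields the cyclic predecessor of a row. Here the rows
  starting with \<open>ay\<close> are sorted by orderings unrelated to those that sort the rows
  starting with \<open>y\<close>: ranks still count rows, but no longer order them. The predecessor
  map is therefore approached by refinement: counts, added up in the order \<open>\<pi> x\<close>,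
  subdivide the interval of \<open>x\<close>, and the array supplies the row at which that interval
  begins.

  That array entry is reliable only because the search is breadth-first: all shorter branching
  words, and no longer ones, have been laid out when \<open>x\<close> is found.

  A word is stored as its first symbol and a link to its tail, since spelling out all words would
  take |s|^2 cells; the \<sigma>|s| cells are the two tables of child intervals. The empty word
  heads the queue even for |s| = 1, where it is not branching. The factors 16 for space and 400 for
  time are rounded up generously.\<close>

lemma downset_interval:
  fixes a b :: nat
  assumes "S \<subseteq> {a..<b}" and "\<And>p q. q \<in> S \<Longrightarrow> a \<le> p \<Longrightarrow> p \<le> q \<Longrightarrow> p \<in> S"
  shows "S = {a..<a + card S}"
proof (cases "S = {}")
  case False
  have fin: "finite S" using assms(1) finite_subset by blast
  have "S = {a..<Suc (Max S)}"
  proof (intro equalityI subsetI)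
    fix p assume "p \<in> S"
    then show "p \<in> {a..<Suc (Max S)}" using assms(1) Max_ge[OF fin, of p] by auto
  next
    fix p assume "p \<in> {a..<Suc (Max S)}"
    then show "p \<in> S" using assms(2)[of "Max S" p] Max_in[OF fin False] by auto
  qed
  moreover have "a \<le> Max S" using Max_in[OF fin False] assms(1) by auto
  ultimately show ?thesis by (metis card_atLeastLessThan le_SucI le_add_diff_inverse)
qed simp

text \<open>By monotonicity the sets where \<open>f\<close> stays below a bound are initial segments
  of the interval, and a fibre is the gap between two consecutive ones. The intended
  \<open>f\<close> is the position in \<open>\<pi> x\<close> of the symbol that follows
  \<open>x\<close> in a row.\<close>

lemma mono_fibre_interval:
  fixes f :: "nat \<Rightarrow> nat"
  assumes mono: "\<And>p q. p \<in> {a..<b} \<Longrightarrow> q \<in> {a..<b} \<Longrightarrow> p \<le> q \<Longrightarrow> f p \<le> f q"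
  defines "F \<equiv> \<lambda>t. {p \<in> {a..<b}. f p = t}"
  shows "F t = {a + (\<Sum>u<t. card (F u))..<a + (\<Sum>u<t. card (F u)) + card (F t)}"
proof -
  define G where "G = (\<lambda>t. {p \<in> {a..<b}. f p < t})"
  have G: "G t = {a..<a + card (G t)}" for t
  proof (rule downset_interval[where b = b])
    show "p \<in> G t" if "q \<in> G t" "a \<le> p" "p \<le> q" for p q
      using that mono[of p q] by (auto simp: G_def)
  qed (auto simp: G_def)
  have Suc: "card (G (Suc t)) = card (G t) + card (F t)" for t
  proof -
    have "G (Suc t) = G t \<union> F t" "G t \<inter> F t = {}" by (auto simp: G_def F_def)
    moreover have "finite (G t)" "finite (F t)" by (auto simp: G_def F_def)
    ultimately show ?thesis by (simp add: card_Un_disjoint)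
  qed
  have sum: "card (G t) = (\<Sum>u<t. card (F u))" for t
    by (induction t) (simp_all add: Suc, simp add: G_def)
  have "F t = G (Suc t) - G t" by (auto simp: G_def F_def)
  also have "\<dots> = {a + card (G t)..<a + card (G (Suc t))}"
    by (subst (1 2) G) auto
  finally show ?thesis by (simp add: Suc sum add.assoc)
qed

lemma rotate1_last_butlast: "u \<noteq> [] \<Longrightarrow> rotate1 (last u # butlast u) = u"
  by simp

lemma rotate1_inject: "rotate1 u = rotate1 v \<Longrightarrow> u = v"
  by (cases u; cases v) auto

lemma longest_common_prefix_diff:
  "c \<noteq> d \<Longrightarrow> longest_common_prefix (x @ c # u) (x @ d # v) = x"
  by (induction x) auto

lemma prefix_snoc_iff:
  "prefix (x @ [c]) u \<longleftrightarrow> prefix x u \<and> length x < length u \<and> u ! length x = c"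
  by (induction x arbitrary: u; case_tac u) auto

lemma rank_Suc:
  "j < length b \<Longrightarrow> rank b a (Suc j) = rank b a j + of_bool (b ! j = a)"
  by (simp add: rank_def take_Suc_conv_app_nth)

lemma rank_diff:
  assumes "i \<le> j" "j \<le> length b"
  shows "rank b a j = rank b a i + card {p \<in> {i..<j}. b ! p = a}"
  using assms
proof (induction j rule: dec_induct)
  case (step j)
  have "{p \<in> {i..<Suc j}. b ! p = a} =
      (if b ! j = a then insert j {p \<in> {i..<j}. b ! p = a} else {p \<in> {i..<j}. b ! p = a})"
    using step.hyps by (auto simp: less_Suc_eq)
  then show ?case using step by (simp add: rank_Suc)
qed simp

section \<open>Rows of the matrix and the cyclic predecessor map\<close>

locale ctx_bwt_instance =
  fixes \<sigma> :: nat and s :: "nat list" and \<pi> :: orderings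
  assumes orderings: "orderings_on \<sigma> \<pi>" and symbols: "set s \<subseteq> {..<\<sigma>}"
    and primitive: "primitive s" and nonempty: "s \<noteq> []"
begin

definition n :: nat where "n = length s"
definition row :: "nat \<Rightarrow> nat list" where "row p = ctx_matrix \<pi> s ! p"
definition b :: "nat list" where "b = ctx_bwt \<pi> s"

lemma n_pos: "0 < n"
  using nonempty by (simp add: n_def)

lemma matrix_mset: "mset (ctx_matrix \<pi> s) = mset (rotations s)"
  by (rule ctx_matrix(1)[OF orderings symbols])

lemma matrix_length: "length (ctx_matrix \<pi> s) = n"
  using mset_eq_length[OF matrix_mset] by (simp add: rotations_def n_def)

lemma matrix_distinct: "distinct (ctx_matrix \<pi> s)"
  using mset_eq_imp_distinct_iff[OF matrix_mset] primitive by (simp add: primitive_def)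

lemma b_length: "length b = n"
  by (simp add: b_def ctx_bwt_def matrix_length)

lemma b_nth: "p < n \<Longrightarrow> b ! p = last (row p)"
  by (simp add: b_def ctx_bwt_def matrix_length row_def)

lemma row_rotation: "p < n \<Longrightarrow> \<exists>k. row p = rotate k s"
  using mset_eq_setD[OF matrix_mset] nth_mem[of p "ctx_matrix \<pi> s"]
  by (auto simp: matrix_length row_def rotations_def)

lemma rotation_row: "\<exists>p<n. row p = rotate k s"
proof -
  have "rotate k s = rotate (k mod n) s" "k mod n < n"
    using n_pos by (simp_all add: n_def rotate_conv_mod[symmetric])
  then have "rotate k s \<in> set (ctx_matrix \<pi> s)"
    using mset_eq_setD[OF matrix_mset] by (auto simp: rotations_def n_def)
  then show ?thesis by (auto simp: in_set_conv_nth matrix_length row_def)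
qed

lemma row_length: "p < n \<Longrightarrow> length (row p) = n"
  using row_rotation[of p] by (auto simp: n_def)

lemma row_ne: "p < n \<Longrightarrow> row p \<noteq> []"
  using row_length[of p] n_pos by auto

lemma row_symbols: "p < n \<Longrightarrow> set (row p) \<subseteq> {..<\<sigma>}"
  using row_rotation[of p] symbols by auto

lemma row_mset: "p < n \<Longrightarrow> mset (row p) = mset s"
  using row_rotation[of p]
  by (metis append_take_drop_id mset_append rotate_drop_take union_commute)

lemma row_inject: "p < n \<Longrightarrow> q < n \<Longrightarrow> row p = row q \<Longrightarrow> p = q"
  using matrix_distinct by (simp add: row_def matrix_length nth_eq_iff_index_eq)

lemma b_less: "p < n \<Longrightarrow> b ! p < \<sigma>"
  using last_in_set[of "row p"] row_symbols[of p] row_ne[of p] by (auto simp: b_nth simp del: last_in_set)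

lemma row_less: "p < q \<Longrightarrow> q < n \<Longrightarrow> ctx_less \<pi> (row p) (row q)"
  using sorted_wrt_nth_less[OF ctx_matrix(2)[OF orderings symbols], of p q] row_inject[of p q]
  by (auto simp: matrix_length row_def)

text \<open>The LF-mapping of the transform. Under context orderings no rank formula gives it, so it
  is described by its row; such a row exists because the rows are closed under rotation, and it is
  unique because \<open>s\<close> is primitive.\<close>

definition lf :: "nat \<Rightarrow> nat" where
  "lf p = (SOME q. q < n \<and> row q = last (row p) # butlast (row p))"

lemma lf: assumes "p < n" shows "lf p < n \<and> row (lf p) = last (row p) # butlast (row p)"
proof -
  let ?u = "last (row p) # butlast (row p)"
  obtain k where k: "row p = rotate k s" using row_rotation assms by blast
  \<comment> \<open>A full turn consists of \<open>length ?u\<close> single rotations, so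
    \<open>length ?u - 1\<close> of them undo \<open>rotate1\<close>. This turns the backward step
    into a forward rotation of \<open>s\<close>.\<close>
  have "?u = rotate (length ?u - 1) (rotate1 ?u)"
    by (simp only: rotate1_rotate_swap[symmetric]) (simp add: rotate_id flip: rotate_Suc)
  also have "\<dots> = rotate (length ?u - 1) (rotate k s)"
    using rotate1_last_butlast row_ne[OF assms] k by metis
  finally have "\<exists>j. ?u = rotate j s" by (metis rotate_rotate)
  then have "\<exists>q. q < n \<and> row q = ?u" using rotation_row by metis
  then show ?thesis unfolding lf_def by (rule someI_ex)
qed

lemma lf_less: "p < n \<Longrightarrow> lf p < n"
  using lf by blast

lemma row_lf: "p < n \<Longrightarrow> row (lf p) = b ! p # butlast (row p)"
  using lf by (simp add: b_nth)

lemma lf_rotate: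
  assumes "p < n" "row p = rotate (Suc k) s" shows "row (lf p) = rotate k s"
  by (metis assms lf rotate1_inject rotate1_last_butlast rotate_Suc row_ne)

lemma lf_inject: assumes "p < n" "q < n" "lf p = lf q" shows "p = q"
proof -
  have "row p = row q"
    using assms lf[of p] lf[of q] rotate1_last_butlast row_ne by metis
  then show ?thesis using assms row_inject by blast
qed

lemma lf_surj: assumes "q < n" obtains p where "p < n" "q = lf p"
proof -
  have "inj_on lf {..<n}" using lf_inject by (auto simp: inj_on_def)
  moreover have "lf ` {..<n} \<subseteq> {..<n}" using lf_less by auto
  ultimately have "lf ` {..<n} = {..<n}" by (simp add: endo_inj_surj)
  then show thesis using assms that by (metis imageE lessThan_iff)
qed

lemma last_rotate: "k < n \<Longrightarrow> last (rotate (Suc k) s) = s ! k"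
proof -
  assume k: "k < n"
  have "last (rotate (Suc k) s) = rotate (Suc k) s ! (n - 1)"
    using k by (subst last_conv_nth) (auto simp: n_def)
  also have "\<dots> = s ! ((Suc k + (n - 1)) mod n)"
    using k by (subst nth_rotate) (auto simp: n_def)
  also have "Suc k + (n - 1) = k + n" using k by simp
  finally show ?thesis using k by simp
qed

section \<open>The interval of rows with a given prefix\<close>

definition Pre :: "nat list \<Rightarrow> nat set" where
  "Pre x = {p. p < n \<and> prefix x (row p)}"
definition cnt :: "nat list \<Rightarrow> nat" where "cnt x = card (Pre x)"
text \<open>A sum of counts rather than a minimum of \<open>Pre x\<close>, so that it is meaningful
  also for words that start no row, and so that \<open>lo_snoc\<close> is the recurrence which the
  layout loop computes.\<close>

definition lo :: "nat list \<Rightarrow> nat" where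
  "lo x = (\<Sum>k<length x. \<Sum>t<\<pi> (take k x) (x ! k). cnt (take k x @ [inv (\<pi> (take k x)) t]))"
definition hi :: "nat list \<Rightarrow> nat" where "hi x = lo x + cnt x"

lemma Pre_less: "p \<in> Pre x \<Longrightarrow> p < n"
  by (simp add: Pre_def)

lemma finite_Pre: "finite (Pre x)"
  by (simp add: Pre_def)

lemma Pre_Nil: "Pre [] = {..<n}"
  by (auto simp: Pre_def)

lemma lo_Nil: "lo [] = 0" by (simp add: lo_def)

lemma hi_Nil: "hi [] = n" by (simp add: hi_def lo_Nil cnt_def Pre_Nil)

lemma lo_snoc: "lo (x @ [c]) = lo x + (\<Sum>t<\<pi> x c. cnt (x @ [inv (\<pi> x) t]))"
  by (simp add: lo_def nth_append)

lemma Pre_snoc: "Pre (x @ [c]) = {p \<in> Pre x. length x < n \<and> row p ! length x = c}"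
  by (auto simp: Pre_def prefix_snoc_iff row_length)

lemma Pre_symbols: "p \<in> Pre x \<Longrightarrow> set x \<subseteq> {..<\<sigma>}"
  using row_symbols[of p] by (auto simp: Pre_def dest: set_mono_prefix)

lemma Pre_nth_less: "p \<in> Pre x \<Longrightarrow> length x < n \<Longrightarrow> row p ! length x < \<sigma>"
  using row_symbols[of p] row_length[of p] nth_mem[of "length x" "row p"]
  unfolding Pre_def by (metis (mono_tags) lessThan_iff mem_Collect_eq subsetD)

lemma order_permutes: "set x \<subseteq> {..<\<sigma>} \<Longrightarrow> \<pi> x permutes {..<\<sigma>}"
  using orderings by (simp add: orderings_on_def)

lemma lcp_rows:
  assumes "p \<in> Pre x" "q \<in> Pre x" "length x < n" "row p ! length x \<noteq> row q ! length x"
  shows "longest_common_prefix (row p) (row q) = x"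
proof -
  have "row z = x @ row z ! length x # drop (Suc (length x)) (row z)" if "z \<in> Pre x" for z
    using that assms(3) row_length[of z]
    by (auto simp: Pre_def prefix_def Cons_nth_drop_Suc)
  then show ?thesis
    using assms by (metis longest_common_prefix_diff)
qed

text \<open>Two rows that first differ right after \<open>x\<close> have longest common prefix
  \<open>x\<close>, so the matrix compares them by \<open>\<pi> x\<close>.\<close>

lemma Pre_mono_order:
  assumes "p \<in> Pre x" "q \<in> Pre x" "length x < n" "p \<le> q"
  shows "\<pi> x (row p ! length x) \<le> \<pi> x (row q ! length x)"
proof (cases "row p ! length x = row q ! length x")
  case False
  then have "p < q" using assms(4) by (auto simp: le_less)
  then show ?thesis
    using row_less[of p q] assms lcp_rows[OF assms(1-3) False]
    by (auto simp: ctx_less_def Let_def Pre_def)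
qed simp

text \<open>Inside the interval of \<open>x\<close> the next symbols appear in the order
  \<open>\<pi> x\<close>; the rows continuing with \<open>c\<close> are one fibre of a monotone
  function.\<close>

lemma Pre_interval:
  assumes "length x \<le> n" "set x \<subseteq> {..<\<sigma>}"
  shows "Pre x = {lo x..<hi x}"
  using assms
proof (induction x rule: rev_induct)
  case Nil
  then show ?case by (auto simp: Pre_Nil lo_Nil hi_Nil)
next
  case (snoc c x)
  then have IH: "Pre x = {lo x..<hi x}" and l: "length x < n" and c: "c < \<sigma>" by auto
  have perm: "\<pi> x permutes {..<\<sigma>}" using snoc.prems order_permutes by simp
  let ?f = "\<lambda>p. \<pi> x (row p ! length x)"
  have F: "{p \<in> {lo x..<hi x}. ?f p = t} = Pre (x @ [inv (\<pi> x) t])" for t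
    using perm permutes_inverses[OF perm] l by (auto simp: Pre_snoc IH)
  have "{p \<in> {lo x..<hi x}. ?f p = \<pi> x c} = {lo (x @ [c])..<lo (x @ [c]) + cnt (x @ [c])}"
    using mono_fibre_interval[of "lo x" "hi x" ?f "\<pi> x c"] Pre_mono_order[of _ x] l
    unfolding F lo_snoc cnt_def IH by (simp add: permutes_inverses[OF perm] add.assoc)
  then show ?case unfolding F hi_def[of "x @ [c]"] by (simp add: permutes_inverses[OF perm])
qed

text \<open>The right-branching factors of the cyclic word \<open>s\<close>, that is, the internal
  nodes of its suffix tree. Only for these words does \<open>\<pi> x\<close> influence the
  matrix.\<close>

definition branching :: "nat list \<Rightarrow> bool" where
  "branching x \<longleftrightarrow> length x < n \<and> (\<exists>p\<in>Pre x. \<exists>q\<in>Pre x. row p ! length x \<noteq> row q ! length x)"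

lemma branching_symbols: "branching x \<Longrightarrow> set x \<subseteq> {..<\<sigma>}"
  using Pre_symbols by (auto simp: branching_def)

lemma branching_adjacent:
  assumes "branching x"
  shows "x \<in> (\<lambda>t. longest_common_prefix (row t) (row (Suc t))) ` {..<n - 1}"
proof -
  let ?l = "\<lambda>p. row p ! length x"
  obtain p q where pq: "p \<in> Pre x" "q \<in> Pre x" "?l p \<noteq> ?l q" "p < q"
    using assms unfolding branching_def by (metis linorder_neqE_nat)
  have I: "Pre x = {lo x..<hi x}"
    using assms branching_symbols by (intro Pre_interval) (auto simp: branching_def)
  \<comment> \<open>On the way from row \<open>p\<close> to row \<open>q\<close> the symbol after
    \<open>x\<close> has to change between two neighbours, and both lie in \<open>Pre x\<close>
    because it is an interval.\<close>
  have "\<exists>t. p \<le> t \<and> t < q \<and> ?l t \<noteq> ?l (Suc t)"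
  proof (rule ccontr)
    assume H: "\<not> ?thesis"
    have "z \<le> q \<longrightarrow> ?l z = ?l p" if "p \<le> z" for z
      using that
    proof (induction z rule: dec_induct)
      case (step z)
      then show ?case using H by (metis Suc_le_lessD less_imp_le)
    qed simp
    from this[of q] show False using pq by simp
  qed
  then obtain t where t: "p \<le> t" "t < q" "?l t \<noteq> ?l (Suc t)" by blast
  have in_Pre: "t \<in> Pre x" "Suc t \<in> Pre x" using t pq I by auto
  then have "longest_common_prefix (row t) (row (Suc t)) = x"
    using lcp_rows t(3) assms by (auto simp: branching_def)
  moreover have "t < n - 1" using Pre_less[OF in_Pre(2)] by simp
  ultimately show ?thesis by blast
qed

lemma branching_finite_card: "finite {x. branching x}" "card {x. branching x} \<le> n - 1"
proof -
  let ?S = "(\<lambda>t. longest_common_prefix (row t) (row (Suc t))) ` {..<n - 1}"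
  have sub: "{x. branching x} \<subseteq> ?S" using branching_adjacent by auto
  then show "finite {x. branching x}" by (rule finite_subset) simp
  have "card {x. branching x} \<le> card ?S" using sub by (intro card_mono) auto
  also have "\<dots> \<le> n - 1" using card_image_le[of "{..<n - 1}"] by fastforce
  finally show "card {x. branching x} \<le> n - 1" .
qed

text \<open>\<open>lf\<close> moves the last symbol \<open>b ! p\<close> of row \<open>p\<close> to
  the front. As \<open>y\<close> is shorter than a row, removing the last symbol does not affect
  whether \<open>y\<close> is a prefix.\<close>

lemma lf_Pre_Cons:
  assumes "p < n" "length y < n"
  shows "lf p \<in> Pre (a # y) \<longleftrightarrow> b ! p = a \<and> p \<in> Pre y"
proof -
  have "prefix y (butlast (row p)) \<longleftrightarrow> prefix y (row p)"
  proof -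
    have "row p = butlast (row p) @ [last (row p)]" using row_ne[OF assms(1)] by simp
    then have "prefix y (row p) \<longleftrightarrow> y = row p \<or> prefix y (butlast (row p))"
      by (metis prefix_snoc)
    then show ?thesis using row_length[OF assms(1)] assms(2) by auto
  qed
  then show ?thesis
    using assms lf_less[OF assms(1)] by (auto simp: Pre_def row_lf)
qed

text \<open>The counting half of backward search: \<open>lf\<close> maps the rows on the right
  bijectively onto those on the left. It survives context orderings because it says nothing about
  their order.\<close>

lemma cnt_Cons:
  assumes "length y < n"
  shows "cnt (a # y) = card {p \<in> Pre y. b ! p = a}"
proof -
  have "Pre (a # y) = lf ` {p \<in> Pre y. b ! p = a}"
  proof (intro equalityI subsetI)
    fix q assume q: "q \<in> Pre (a # y)"
    obtain p where "p < n" "q = lf p" using lf_surj Pre_less[OF q] by blast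
    then show "q \<in> lf ` {p \<in> Pre y. b ! p = a}"
      using q lf_Pre_Cons[of p y a] assms by blast
  qed (use lf_Pre_Cons assms Pre_less in blast)
  moreover have "inj_on lf {p \<in> Pre y. b ! p = a}"
    using lf_inject Pre_less by (auto simp: inj_on_def)
  ultimately show ?thesis by (simp add: cnt_def card_image)
qed

lemma row_lf_nth:
  "p < n \<Longrightarrow> Suc k < n \<Longrightarrow> row (lf p) ! Suc k = row p ! k"
  by (simp add: row_lf nth_butlast row_length)

text \<open>All rows are permutations of one multiset, so \<open>n - 1\<close> symbols of a row
  determine the last one. This keeps branching words shorter than \<open>n\<close> under left
  extension.\<close>

lemma Pre_same_last:
  assumes "p \<in> Pre y" "q \<in> Pre y" "Suc (length y) = n"
  shows "p = q"
proof -
  have ap: "row z = y @ [last (row z)]" if "z \<in> Pre y" for z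
  proof -
    have "length (row z) = Suc (length y)" using that assms(3) row_length[of z] by (auto simp: Pre_def)
    then have "length (drop (length y) (row z)) = 1" by simp
    then show ?thesis using that
      by (auto simp: Pre_def prefix_def length_Suc_conv)
  qed
  have "mset (row p) = mset (row q)" using assms row_mset by (auto simp: Pre_def)
  then have "last (row p) = last (row q)"
    using ap[OF assms(1)] ap[OF assms(2)] by (metis add_left_imp_eq mset_append mset_single_iff_right)
  then show ?thesis using ap[OF assms(1)] ap[OF assms(2)] row_inject Pre_less assms by metis
qed

lemma branching_Cons:
  assumes "length y < n"
  shows "branching (a # y) \<longleftrightarrow>
    (\<exists>p\<in>Pre y. \<exists>q\<in>Pre y. b ! p = a \<and> b ! q = a \<and> row p ! length y \<noteq> row q ! length y)"
    (is "?B \<longleftrightarrow> ?E")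
proof
  assume ?B
  then obtain p' q' where *: "Suc (length y) < n" "p' \<in> Pre (a # y)" "q' \<in> Pre (a # y)"
    "row p' ! Suc (length y) \<noteq> row q' ! Suc (length y)" by (auto simp: branching_def)
  obtain p q where "p < n" "q < n" "p' = lf p" "q' = lf q"
    using lf_surj Pre_less *(2,3) by metis
  then show ?E using * lf_Pre_Cons[OF _ assms, of p a] lf_Pre_Cons[OF _ assms, of q a]
      row_lf_nth[of p "length y"] row_lf_nth[of q "length y"] by auto
next
  assume ?E
  then obtain p q where *: "p \<in> Pre y" "q \<in> Pre y" "b ! p = a" "b ! q = a"
    "row p ! length y \<noteq> row q ! length y" by blast
  then have "Suc (length y) < n" using Pre_same_last[of p y q] assms by (cases "Suc (length y) = n") auto
  moreover have "p < n" "q < n" using * Pre_less by auto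
  ultimately show ?B
    using * lf_Pre_Cons[OF _ assms, of p a] lf_Pre_Cons[OF _ assms, of q a]
      row_lf_nth[of p "length y"] row_lf_nth[of q "length y"]
    unfolding branching_def by (intro conjI bexI[of _ "lf p"] bexI[of _ "lf q"]) auto
qed

lemma branching_tl: "branching (a # y) \<Longrightarrow> branching y"
proof -
  assume B: "branching (a # y)"
  then have "length y < n" by (simp add: branching_def)
  then show "branching y" using B branching_Cons[of y a] unfolding branching_def[of y] by blast
qed

section \<open>Breadth-first search over branching words\<close>

definition separated :: "nat list set \<Rightarrow> nat \<Rightarrow> nat \<Rightarrow> bool" where
  "separated W q r \<longleftrightarrow>
     (\<exists>x\<in>W. length x < n \<and> q \<in> Pre x \<and> r \<in> Pre x \<and> row q ! length x \<noteq> row r ! length x)"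

text \<open>Non-separation need not be transitive for arbitrary \<open>W\<close>: a row outside
  \<open>Pre x\<close> is separated by \<open>x\<close> from no row. Values are therefore computed
  only where the rows not separated from \<open>q\<close> are known to be some
  \<open>Pre z\<close>.\<close>

definition block_start :: "nat list set \<Rightarrow> nat \<Rightarrow> nat" where
  "block_start W q = (LEAST r. r < n \<and> \<not> separated W q r)"

lemma block_start_eq:
  assumes "\<And>r. r < n \<Longrightarrow> \<not> separated W q r \<longleftrightarrow> r \<in> Pre z" "q \<in> Pre z" "length z \<le> n"
  shows "block_start W q = lo z"
  unfolding block_start_def
proof (rule Least_equality)
  have I: "Pre z = {lo z..<hi z}" using assms Pre_symbols by (intro Pre_interval) auto
  show "lo z < n \<and> \<not> separated W q (lo z)"
    using I assms(1)[of "lo z"] assms(2) Pre_less[of q z] by auto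
  show "lo z \<le> r" if "r < n \<and> \<not> separated W q r" for r
    using that I assms(1) by auto
qed

lemma Pre_nth_snoc: "q \<in> Pre x \<Longrightarrow> length x < n \<Longrightarrow> q \<in> Pre (x @ [row q ! length x])"
  by (simp add: Pre_snoc)

lemma block_start_Nil:
  assumes "q < n" shows "block_start {[]} q = lo [row q ! 0]"
proof (rule block_start_eq)
  show "\<not> separated {[]} q r \<longleftrightarrow> r \<in> Pre [row q ! 0]" if "r < n" for r
    using that assms n_pos Pre_snoc[of "[]"] by (auto simp: separated_def Pre_Nil)
  show "q \<in> Pre [row q ! 0]" using Pre_nth_snoc[of q "[]"] assms n_pos by (simp add: Pre_Nil)
qed (use n_pos in simp)

lemma first_difference:
  assumes "q < n" "r < n" "q \<in> Pre z" "r \<notin> Pre z"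
  obtains x where "length x < length z" "length x < n" "q \<in> Pre x" "r \<in> Pre x"
    "row q ! length x \<noteq> row r ! length x"
proof -
  have "\<exists>x. length x < length z \<and> length x < n \<and> q \<in> Pre x \<and> r \<in> Pre x \<and>
    row q ! length x \<noteq> row r ! length x"
    using assms(3,4)
  proof (induction z rule: rev_induct)
    case Nil then show ?case using assms by (simp add: Pre_Nil)
  next
    case (snoc c z)
    show ?case
    proof (cases "r \<in> Pre z")
      case True
      then show ?thesis using snoc.prems by (intro exI[of _ z]) (auto simp: Pre_snoc)
    next
      case False
      have "q \<in> Pre z" using snoc.prems by (simp add: Pre_snoc)
      then obtain x where "length x < length z \<and> length x < n \<and> q \<in> Pre x \<and> r \<in> Pre x \<and>
          row q ! length x \<noteq> row r ! length x" using snoc.IH False by blast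
      then show ?thesis by (intro exI[of _ x]) auto
    qed
  qed
  then show thesis using that by blast
qed

lemma branchingI:
  "length x < n \<Longrightarrow> q \<in> Pre x \<Longrightarrow> r \<in> Pre x \<Longrightarrow> row q ! length x \<noteq> row r ! length x \<Longrightarrow> branching x"
  by (auto simp: branching_def)

lemma Pre_same_length: "q \<in> Pre x \<Longrightarrow> q \<in> Pre y \<Longrightarrow> length x \<le> length y \<Longrightarrow> prefix x y"
  by (auto simp: Pre_def intro: prefix_length_prefix)

text \<open>Rows inside and outside \<open>Pre z\<close> part after a word shorter than
  \<open>z\<close>; that word is branching and hence in \<open>W\<close>.\<close>

lemma separated_outside:
  assumes "\<And>y. branching y \<Longrightarrow> length y < length z \<Longrightarrow> y \<in> W"
    and "q \<in> Pre z" "r < n" "r \<notin> Pre z"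
  shows "separated W q r"
proof -
  obtain x where "length x < length z" "length x < n" "q \<in> Pre x" "r \<in> Pre x"
    "row q ! length x \<noteq> row r ! length x"
    using first_difference[OF _ assms(3,2,4)] Pre_less assms(2) by blast
  then show ?thesis using assms(1) branchingI unfolding separated_def by blast
qed

text \<open>A word of \<open>W\<close> that starts row \<open>q\<close> is no longer than
  \<open>x\<close>, hence a prefix of \<open>x\<close>, and a proper one since \<open>x\<close> is
  not in \<open>W\<close>. The symbol after it then belongs to \<open>x\<close> and is the same in
  both rows.\<close>

lemma not_separated_inside:
  assumes "\<And>y. y \<in> W \<Longrightarrow> length y \<le> length x" "x \<notin> W" "q \<in> Pre x" "r \<in> Pre x"
  shows "\<not> separated W q r"
proof
  assume "separated W q r"
  then obtain y where y: "y \<in> W" "length y < n" "q \<in> Pre y" "r \<in> Pre y"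
    "row q ! length y \<noteq> row r ! length y" by (auto simp: separated_def)
  have "prefix y x" using Pre_same_length y assms by blast
  moreover have "x \<noteq> y" using y(1) assms(2) by blast
  ultimately have "length y < length x" by (auto simp: prefix_def)
  have "row q ! length y = x ! length y" "row r ! length y = x ! length y"
    using assms(3,4) \<open>length y < length x\<close> by (auto simp: Pre_def prefix_def nth_append)
  then show False using y(5) by simp
qed

text \<open>This is where breadth-first order is used: knowing all shorter branching words separates
  \<open>q\<close> from every row outside \<open>Pre x\<close>, and knowing no longer ones leaves
  \<open>Pre x\<close> in one piece.\<close>

lemma block_start_new:
  assumes "branching x" "x \<notin> W" "\<And>y. branching y \<Longrightarrow> length y < length x \<Longrightarrow> y \<in> W"
    and "\<And>y. y \<in> W \<Longrightarrow> length y \<le> length x" and "q \<in> Pre x"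
  shows "block_start W q = lo x"
proof (rule block_start_eq)
  show "\<not> separated W q r \<longleftrightarrow> r \<in> Pre x" if "r < n" for r
    using separated_outside[of x W q r] not_separated_inside[of W x q r] assms that by blast
qed (use assms in \<open>auto simp: branching_def\<close>)

text \<open>Adding \<open>x\<close> cuts the block \<open>Pre x\<close> by the symbol after
  \<open>x\<close> and leaves all other rows alone, so only array entries whose predecessor lies in
  \<open>Pre x\<close> have to be rewritten.\<close>

lemma block_start_insert:
  assumes "branching x" "x \<notin> W" "\<And>y. branching y \<Longrightarrow> length y < length x \<Longrightarrow> y \<in> W"
    and "\<And>y. y \<in> W \<Longrightarrow> length y \<le> length x" and "q < n"
  shows "block_start (insert x W) q =
    (if q \<in> Pre x then lo (x @ [row q ! length x]) else block_start W q)"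
proof (cases "q \<in> Pre x")
  case True
  have l: "length x < n" using assms(1) by (simp add: branching_def)
  have "block_start (insert x W) q = lo (x @ [row q ! length x])"
  proof (rule block_start_eq)
    show "\<not> separated (insert x W) q r \<longleftrightarrow> r \<in> Pre (x @ [row q ! length x])" if "r < n" for r
    proof -
      have "separated (insert x W) q r \<longleftrightarrow>
          separated W q r \<or> r \<in> Pre x \<and> row q ! length x \<noteq> row r ! length x"
        using True l by (auto simp: separated_def)
      moreover have "separated W q r \<longleftrightarrow> r \<notin> Pre x"
        using separated_outside[of x W q r] not_separated_inside[of W x q r] assms True that by blast
      ultimately show ?thesis using l by (auto simp: Pre_snoc)
    qed
  qed (use True l Pre_nth_snoc in auto)
  then show ?thesis using True by simp
next
  case False
  then have "separated (insert x W) q = separated W q" by (auto simp: separated_def)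
  then show ?thesis using False by (simp add: block_start_def)
qed

text \<open>A full row is a word of length \<open>n\<close> that starts no other row; any other row
  is separated from it by a branching word.\<close>

lemma block_start_complete:
  assumes "\<And>x. branching x \<Longrightarrow> x \<in> W" "q < n"
  shows "block_start W q = q"
proof -
  have q: "q \<in> Pre (row q)" using assms(2) by (simp add: Pre_def)
  have P: "Pre (row q) = {q}"
  proof -
    have "r = q" if "r \<in> Pre (row q)" for r
      using that row_length[of r] row_length[of q] row_inject[of r q] assms(2)
      by (auto simp: Pre_def prefix_def)
    then show ?thesis using q by blast
  qed
  have "block_start W q = lo (row q)"
  proof (rule block_start_eq)
    show "\<not> separated W q r \<longleftrightarrow> r \<in> Pre (row q)" if "r < n" for r
      using separated_outside[of "row q" W q r] assms q P that by (auto simp: separated_def)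
  qed (use q assms row_length in auto)
  moreover have "Pre (row q) = {lo (row q)..<hi (row q)}"
    using assms row_length row_symbols by (intro Pre_interval) auto
  then have "lo (row q) = q" using P
    by (metis atLeastLessThan_empty_iff atLeastLessThan_iff insert_not_empty leD leI order_refl singletonD)
  ultimately show ?thesis by simp
qed

text \<open>\<open>queue ws v A\<close>: the words \<open>ws ! k\<close> with \<open>k < v\<close> have been extended to the left by every symbol,
  and \<open>ws ! v\<close> by the symbols in \<open>A\<close>.\<close>

definition queue :: "nat list list \<Rightarrow> nat \<Rightarrow> nat set \<Rightarrow> bool" where
  "queue ws v A \<longleftrightarrow> ws \<noteq> [] \<and> ws ! 0 = [] \<and> distinct ws \<and> sorted (map length ws) \<and> v \<le> length ws \<and>
     (\<forall>k. 0 < k \<and> k < length ws \<longrightarrow> branching (ws ! k) \<and> (\<exists>j\<le>v. j < length ws \<and> tl (ws ! k) = ws ! j)) \<and>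
     (\<forall>k<v. \<forall>a. branching (a # ws ! k) \<longrightarrow> a # ws ! k \<in> set ws) \<and>
     (v < length ws \<longrightarrow> (\<forall>a\<in>A. branching (a # ws ! v) \<longrightarrow> a # ws ! v \<in> set ws) \<and>
        (\<forall>a. a # ws ! v \<in> set ws \<longrightarrow> a \<in> A))"

lemma queue_root: "queue ws v A \<Longrightarrow> ws \<noteq> [] \<and> ws ! 0 = []"
  by (simp add: queue_def)

lemma queue_parent:
  assumes "queue ws v A" "0 < k" "k < length ws"
  obtains j where "j \<le> v" "j < length ws" "tl (ws ! k) = ws ! j"
  using assms unfolding queue_def by blast

lemma queue_branching:
  assumes "queue ws v A" "x \<in> set ws" "x \<noteq> []" shows "branching x"
proof -
  obtain k where "k < length ws" "x = ws ! k" using assms(2) by (auto simp: in_set_conv_nth)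
  then show ?thesis using assms by (cases k) (auto simp: queue_def)
qed

lemma queue_nth_less: "queue ws v A \<Longrightarrow> k < length ws \<Longrightarrow> length (ws ! k) < n"
  using queue_branching[of ws v A "ws ! k"] n_pos by (cases "ws ! k = []") (auto simp: branching_def)

lemma queue_symbols: "queue ws v A \<Longrightarrow> k < length ws \<Longrightarrow> set (ws ! k) \<subseteq> {..<\<sigma>}"
  using queue_branching[of ws v A "ws ! k"] branching_symbols by (cases "ws ! k = []") auto

lemma queue_sorted: "queue ws v A \<Longrightarrow> j \<le> k \<Longrightarrow> k < length ws \<Longrightarrow> length (ws ! j) \<le> length (ws ! k)"
  using sorted_nth_mono[of "map length ws" j k] by (auto simp: queue_def)

lemma queue_shorter:
  assumes Q: "queue ws v A" and v: "v < length ws"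
  shows "branching x \<Longrightarrow> length x \<le> length (ws ! v) \<Longrightarrow> x \<in> set ws"
proof (induction x)
  case Nil
  then show ?case using Q nth_mem[of 0 ws] by (auto simp: queue_def)
next
  case (Cons a x)
  then have "x \<in> set ws" using branching_tl by force
  then obtain k where k: "k < length ws" "x = ws ! k" by (auto simp: in_set_conv_nth)
  \<comment> \<open>The tail is strictly shorter than \<open>ws ! v\<close>, so by sortedness it
    stands before index \<open>v\<close>; all its branching left extensions are then already in the
    queue.\<close>
  then have "k < v" using queue_sorted[OF Q, of v k] Cons.prems(2) by force
  then show ?case using Q Cons.prems k by (auto simp: queue_def)
qed

text \<open>Every entry but the root is a left extension of a word at an index at most
  \<open>v\<close>, so at most two consecutive lengths are in play. This keeps the queue sorted when
  a word is appended.\<close>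

lemma queue_longer:
  assumes Q: "queue ws v A" and v: "v < length ws" and x: "x \<in> set ws"
  shows "length x \<le> Suc (length (ws ! v))"
proof -
  obtain k where k: "k < length ws" "x = ws ! k" using x by (auto simp: in_set_conv_nth)
  show ?thesis
  proof (cases "k = 0")
    case True then show ?thesis using Q k by (auto simp: queue_def)
  next
    case False
    then obtain j where "j \<le> v" "tl x = ws ! j" using queue_parent[OF Q, of k] k by blast
    then show ?thesis using queue_sorted[OF Q, of j v] v by (cases x) auto
  qed
qed

lemma queue_length: assumes "queue ws v A" shows "length ws \<le> n"
proof -
  \<comment> \<open>\<open>tl\<close> removes the root, the only entry that may fail to be
    branching; it accounts for the step from \<open>n - 1\<close> to \<open>n\<close>.\<close>
  have "set (tl ws) \<subseteq> {x. branching x}"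
  proof
    fix x assume "x \<in> set (tl ws)"
    then obtain k where "k < length ws - 1" "x = ws ! Suc k" by (auto simp: in_set_conv_nth nth_tl)
    then show "x \<in> {x. branching x}" using assms by (auto simp: queue_def)
  qed
  then have "card (set (tl ws)) \<le> n - 1"
    using card_mono branching_finite_card by (metis le_trans)
  moreover have "card (set (tl ws)) = length ws - 1"
    using assms distinct_card[of "tl ws"] by (simp add: queue_def distinct_tl)
  ultimately show ?thesis using n_pos by linarith
qed

lemma queue_add:
  assumes Q: "queue ws v A" and v: "v < length ws" and B: "branching (a # ws ! v)" and a: "a \<notin> A"
  shows "queue (ws @ [a # ws ! v]) v (insert a A)"
proof -
  have new: "a # ws ! v \<notin> set ws" using Q v a by (auto simp: queue_def)
  have srt: "sorted (map length (ws @ [a # ws ! v]))"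
    using Q queue_longer[OF Q v] by (auto simp: queue_def sorted_append)
  have "branching ((ws @ [a # ws ! v]) ! k) \<and>
      (\<exists>j\<le>v. j < length (ws @ [a # ws ! v]) \<and> tl ((ws @ [a # ws ! v]) ! k) = (ws @ [a # ws ! v]) ! j)"
    if "0 < k" "k < length (ws @ [a # ws ! v])" for k
  proof (cases "k < length ws")
    case True
    then obtain j where "j \<le> v" "j < length ws" "tl (ws ! k) = ws ! j"
      using queue_parent[OF Q \<open>0 < k\<close>] by blast
    moreover have "branching (ws ! k)" using Q that True unfolding queue_def by blast
    ultimately show ?thesis using True by (auto simp: nth_append intro!: exI[of _ j])
  next
    case False
    then have "k = length ws" using that by simp
    then show ?thesis using B v by (auto simp: nth_append intro!: exI[of _ v])
  qed
  then show ?thesis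
    using Q new srt v unfolding queue_def by (auto simp: nth_append)
qed

lemma queue_skip:
  assumes "queue ws v A" "v < length ws" "\<not> branching (a # ws ! v)"
  shows "queue ws v (insert a A)"
  using assms by (auto simp: queue_def)

text \<open>Symbols that do not occur in the BWT segment of \<open>ws ! v\<close> give no branching
  extension, so it is enough that \<open>A\<close> contains those that do.\<close>

lemma queue_next:
  assumes Q: "queue ws v A" and v: "v < length ws" and A: "(!) b ` Pre (ws ! v) \<subseteq> A"
  shows "queue ws (Suc v) {}"
proof -
  have "a # ws ! v \<in> set ws" if "branching (a # ws ! v)" for a
  proof -
    have "a \<in> A"
      using that branching_Cons[of "ws ! v" a] A queue_nth_less[OF Q v] by blast
    then show ?thesis using that Q v by (auto simp: queue_def)
  qed
  \<comment> \<open>The tail of an entry has an index at most \<open>v\<close>, and the entries are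
    distinct, so the next word has no left extension in the queue yet.\<close>
  moreover have "a # ws ! Suc v \<notin> set ws" if sv: "Suc v < length ws" for a
  proof
    assume "a # ws ! Suc v \<in> set ws"
    then obtain k where k: "k < length ws" "ws ! k = a # ws ! Suc v" by (auto simp: in_set_conv_nth)
    have "0 < k" using k queue_root[OF Q] by (cases k) auto
    then obtain j where "j \<le> v" "j < length ws" "ws ! Suc v = ws ! j"
      using queue_parent[OF Q, of k] k by auto
    moreover have "distinct ws" using Q by (simp add: queue_def)
    ultimately show False using sv nth_eq_iff_index_eq[of ws "Suc v" j] by simp
  qed
  moreover have "\<exists>j\<le>Suc v. j < length ws \<and> tl (ws ! k) = ws ! j" if "0 < k" "k < length ws" for k
    using queue_parent[OF Q that] le_SucI by metis
  ultimately show ?thesis using Q v unfolding queue_def by (simp add: less_Suc_eq)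
qed

lemma queue_complete:
  assumes "queue ws (length ws) A" "branching x" shows "x \<in> set ws"
  using assms(2)
proof (induction x)
  case Nil
  then show ?case using assms(1) nth_mem[of 0 ws] by (auto simp: queue_def)
next
  case (Cons a x)
  then have "x \<in> set ws" using branching_tl by blast
  then show ?case using Cons.prems assms(1) by (auto simp: queue_def in_set_conv_nth)
qed

lemma queue_block_start:
  assumes Q: "queue ws v A" and v: "v < length ws" and B: "branching (a # ws ! v)" and a: "a \<notin> A"
    and "q < n"
  defines "x \<equiv> a # ws ! v"
  shows "q \<in> Pre x \<Longrightarrow> block_start (set ws) q = lo x"
    and "block_start (set (ws @ [x])) q =
      (if q \<in> Pre x then lo (x @ [row q ! length x]) else block_start (set ws) q)"
proof -
  have 1: "branching x" "x \<notin> set ws" using B Q v a by (auto simp: queue_def x_def)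
  have 2: "y \<in> set ws" if "branching y" "length y < length x" for y
    using queue_shorter[OF Q v, of y] that by (simp add: x_def)
  have 3: "length y \<le> length x" if "y \<in> set ws" for y
    using queue_longer[OF Q v, of y] that by (simp add: x_def)
  show "q \<in> Pre x \<Longrightarrow> block_start (set ws) q = lo x" by (rule block_start_new[OF 1 2 3])
  show "block_start (set (ws @ [x])) q =
      (if q \<in> Pre x then lo (x @ [row q ! length x]) else block_start (set ws) q)"
    using block_start_insert[OF 1 2 3 \<open>q < n\<close>] by simp
qed

text \<open>The symbols handled once the rows in \<open>D\<close> have been visited. Being first
  refers to the whole interval of \<open>y\<close> and not to \<open>D\<close>, so each symbol is
  handled exactly once, in whatever order the rows are visited.\<close>

definition firsts :: "nat list \<Rightarrow> nat set \<Rightarrow> nat set" where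
  "firsts y D = {b ! p |p. p \<in> D \<and> (\<forall>p'\<in>Pre y. p' < p \<longrightarrow> b ! p' \<noteq> b ! p)}"

lemma firsts_insert:
  "firsts y (insert p D) =
     (if \<forall>p'\<in>Pre y. p' < p \<longrightarrow> b ! p' \<noteq> b ! p then insert (b ! p) (firsts y D) else firsts y D)"
  by (auto simp: firsts_def)

lemma firsts_Pre: "firsts y (Pre y) = (!) b ` Pre y"
proof
  show "(!) b ` Pre y \<subseteq> firsts y (Pre y)"
  proof
    fix a assume "a \<in> (!) b ` Pre y"
    then have E: "\<exists>p. p \<in> Pre y \<and> b ! p = a" by auto
    let ?p = "LEAST p. p \<in> Pre y \<and> b ! p = a"
    have "?p \<in> Pre y \<and> b ! ?p = a" using E by (rule LeastI_ex)
    moreover have "b ! p' \<noteq> a" if "p' \<in> Pre y" "p' < ?p" for p' using that not_less_Least by blast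
    ultimately show "a \<in> firsts y (Pre y)" unfolding firsts_def by (smt (verit) mem_Collect_eq)
  qed
qed (auto simp: firsts_def)

lemma not_in_firsts:
  assumes "D \<subseteq> Pre y" "p \<in> Pre y" "p \<notin> D" "\<forall>p'\<in>Pre y. p' < p \<longrightarrow> b ! p' \<noteq> b ! p"
  shows "b ! p \<notin> firsts y D"
proof
  assume "b ! p \<in> firsts y D"
  then obtain r where "r \<in> D" "b ! r = b ! p" "\<forall>p'\<in>Pre y. p' < r \<longrightarrow> b ! p' \<noteq> b ! r"
    by (auto simp: firsts_def)
  then show False using assms by (metis linorder_neqE_nat subsetD)
qed

lemma rank_eq_first:
  assumes "length y \<le> n" "p \<in> Pre y"
  shows "rank b a p = rank b a (lo y) \<longleftrightarrow> (\<forall>p'\<in>Pre y. p' < p \<longrightarrow> b ! p' \<noteq> a)"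
proof -
  have I: "Pre y = {lo y..<hi y}" using assms Pre_symbols by (intro Pre_interval) auto
  have "rank b a p = rank b a (lo y) + card {r \<in> {lo y..<p}. b ! r = a}"
    using assms(2) I Pre_less[OF assms(2)] by (intro rank_diff) (auto simp: b_length)
  moreover have "card {r \<in> {lo y..<p}. b ! r = a} = 0 \<longleftrightarrow> (\<forall>p'\<in>Pre y. p' < p \<longrightarrow> b ! p' \<noteq> a)"
    using I assms(2) by auto
  ultimately show ?thesis by simp
qed

lemma sum_cnt_snoc:
  assumes "length x < n" "set x \<subseteq> {..<\<sigma>}"
  shows "(\<Sum>t<\<sigma>. cnt (x @ [inv (\<pi> x) t])) = cnt x"
proof -
  have "(\<Sum>t<\<sigma>. cnt (x @ [inv (\<pi> x) t])) = (\<Sum>c<\<sigma>. cnt (x @ [c]))"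
    using permutes_inv[OF order_permutes[OF assms(2)]]
    by (intro sum.reindex_bij_betw permutes_imp_bij)
  also have "\<dots> = card (\<Union>c<\<sigma>. Pre (x @ [c]))"
    unfolding cnt_def by (rule card_UN_disjoint[symmetric]) (auto simp: finite_Pre Pre_snoc)
  also have "(\<Union>c<\<sigma>. Pre (x @ [c])) = Pre x"
    using assms Pre_nth_less[of _ x] by (auto simp: Pre_snoc)
  finally show ?thesis by (simp add: cnt_def)
qed

text \<open>Words that start no row are included on purpose: their empty intervals are still passed
  to \<open>Rank\<close>, which has no execution beyond position \<open>n\<close>.\<close>

lemma lo_hi_le:
  assumes "length y \<le> n" "set y \<subseteq> {..<\<sigma>}"
  shows "lo y \<le> hi y" "hi y \<le> n"
proof -
  show "lo y \<le> hi y" by (simp add: hi_def)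
  have "lo y \<le> n"
    using assms
  proof (induction y rule: rev_induct)
    case Nil then show ?case by (simp add: lo_Nil)
  next
    case (snoc c y)
    have "lo (y @ [c]) \<le> lo y + (\<Sum>t<\<sigma>. cnt (y @ [inv (\<pi> y) t]))"
      using permutes_in_image[OF order_permutes, of y c] snoc.prems
      unfolding lo_snoc by (intro add_left_mono sum_mono2) auto
    also have "\<dots> = lo y + cnt y" using snoc.prems by (simp add: sum_cnt_snoc)
    also have "lo y + cnt y \<le> n"
    proof (cases "Pre y = {}")
      case True then show ?thesis using snoc by (simp add: cnt_def)
    next
      case False
      have I: "Pre y = {lo y..<hi y}" using snoc.prems by (intro Pre_interval) auto
      then have "hi y - 1 \<in> Pre y" using False by auto
      then show ?thesis using Pre_less[of "hi y - 1" y] by (simp add: hi_def)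
    qed
    finally show ?case .
  qed
  moreover have "Pre y = {lo y..<hi y}" using assms by (intro Pre_interval) auto
  then have "lo y < hi y \<Longrightarrow> hi y - 1 < n" using Pre_less[of "hi y - 1" y] by auto
  ultimately show "hi y \<le> n" by (cases "lo y < hi y") auto
qed

text \<open>No \<open>b ! p\<close> occurs in the interval of \<open>y\<close> before row
  \<open>p\<close>, so an occurrence at a row continuing \<open>y\<close> with a symbol other than
  \<open>c\<close> can only lie beyond the interval of \<open>y @ [c]\<close>.\<close>

lemma rank_less_branching:
  assumes l: "length y < n" and c: "p \<in> Pre (y @ [c])"
    and first: "\<forall>p'\<in>Pre y. p' < p \<longrightarrow> b ! p' \<noteq> b ! p"
  shows "rank b (b ! p) (hi (y @ [c])) < rank b (b ! p) (hi y) \<longleftrightarrow> branching (b ! p # y)"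
proof -
  let ?a = "b ! p"
  have sy: "set y \<subseteq> {..<\<sigma>}" "set (y @ [c]) \<subseteq> {..<\<sigma>}" using Pre_symbols[OF c] by auto
  have I: "Pre y = {lo y..<hi y}" "Pre (y @ [c]) = {lo (y @ [c])..<hi (y @ [c])}"
    using l sy by (auto intro!: Pre_interval)
  have py: "p \<in> Pre y" "row p ! length y = c" using c by (auto simp: Pre_snoc)
  have le: "hi (y @ [c]) \<le> hi y"
  proof -
    have "hi (y @ [c]) - 1 \<in> Pre (y @ [c])" using c I(2) by auto
    then have "hi (y @ [c]) - 1 \<in> Pre y" by (simp add: Pre_snoc)
    then show ?thesis using I(1) by auto
  qed
  have "rank b ?a (hi y) = rank b ?a (hi (y @ [c])) + card {r \<in> {hi (y @ [c])..<hi y}. b ! r = ?a}"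
    using le lo_hi_le[of y] l sy by (intro rank_diff) (auto simp: b_length)
  then have "rank b ?a (hi (y @ [c])) < rank b ?a (hi y) \<longleftrightarrow>
      (\<exists>r\<in>{hi (y @ [c])..<hi y}. b ! r = ?a)"
    by (auto simp: card_gt_0_iff)
  also have "\<dots> \<longleftrightarrow> branching (?a # y)"
  proof
    assume "\<exists>r\<in>{hi (y @ [c])..<hi y}. b ! r = ?a"
    then obtain r where r: "hi (y @ [c]) \<le> r" "r < hi y" "b ! r = ?a" by auto
    have "p < r" using c I(2) r by auto
    then have "r \<in> Pre y" using py(1) I(1) r by auto
    moreover have "r \<notin> Pre (y @ [c])" using I(2) r by auto
    ultimately have "row r ! length y \<noteq> row p ! length y" using l py by (auto simp: Pre_snoc)
    then show "branching (?a # y)" using branching_Cons[OF l] py(1) \<open>r \<in> Pre y\<close> r(3) by blast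
  next
    assume "branching (?a # y)"
    then obtain r where r: "r \<in> Pre y" "b ! r = ?a" "row r ! length y \<noteq> c"
      unfolding branching_Cons[OF l] by metis
    then have "p \<le> r" using first by (metis leI)
    moreover have "r \<notin> Pre (y @ [c])" using r by (auto simp: Pre_snoc)
    ultimately have "hi (y @ [c]) \<le> r" using I(2) c by auto
    then show "\<exists>r\<in>{hi (y @ [c])..<hi y}. b ! r = ?a" using r I(1) by auto
  qed
  finally show ?thesis .
qed

end

section \<open>A program logic for the word RAM\<close>

text \<open>\<open>T\<close> is a time budget; the postcondition \<open>Q\<close> sees the final state and what is left of the budget.\<close>

definition runs ::
  "nat \<Rightarrow> nat \<Rightarrow> nat list \<Rightarrow> orderings \<Rightarrow> prog \<Rightarrow> state \<Rightarrow> nat \<Rightarrow> (state \<Rightarrow> nat \<Rightarrow> bool) \<Rightarrow> bool"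
  where "runs w m b \<pi> P st T Q \<longleftrightarrow> (\<exists>t st'. t \<le> T \<and> exec w m b \<pi> P st t st' \<and> Q st' (T - t))"

lemma runs_Const:
  "1 \<le> T \<Longrightarrow> Q (r(d := k mod 2 ^ w), M) (T - 1) \<Longrightarrow> runs w m b \<pi> (Const d k) (r, M) T Q"
  unfolding runs_def by (meson exec.Const)

lemma runs_Op:
  "1 \<le> T \<Longrightarrow> Q (r(d := eval_binop w f (r x) (r y) mod 2 ^ w), M) (T - 1) \<Longrightarrow>
   runs w m b \<pi> (Op f d x y) (r, M) T Q"
  unfolding runs_def by (meson exec.Op)

lemma runs_Load:
  "1 \<le> T \<Longrightarrow> r a < m \<Longrightarrow> Q (r(d := M (r a)), M) (T - 1) \<Longrightarrow> runs w m b \<pi> (Load d a) (r, M) T Q"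
  unfolding runs_def by (meson exec.Load)

lemma runs_Store:
  "1 \<le> T \<Longrightarrow> r a < m \<Longrightarrow> Q (r, M(r a := r x)) (T - 1) \<Longrightarrow> runs w m b \<pi> (Store a x) (r, M) T Q"
  unfolding runs_def by (meson exec.Store)

lemma runs_Bwt:
  "1 \<le> T \<Longrightarrow> r j < length b \<Longrightarrow> Q (r(d := b ! r j mod 2 ^ w), M) (T - 1) \<Longrightarrow>
   runs w m b \<pi> (Bwt d j) (r, M) T Q"
  unfolding runs_def by (meson exec.Bwt)

lemma runs_Rank:
  "1 \<le> T \<Longrightarrow> r j \<le> length b \<Longrightarrow> Q (r(d := rank b (r c) (r j) mod 2 ^ w), M) (T - 1) \<Longrightarrow>
   runs w m b \<pi> (Rank d c j) (r, M) T Q"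
  unfolding runs_def by (meson exec.Rank)

lemma runs_Order:
  "1 + r l \<le> T \<Longrightarrow> r a + r l \<le> m \<Longrightarrow>
   Q (r(d := \<pi> (map M [r a..<r a + r l]) (r c) mod 2 ^ w), M) (T - (1 + r l)) \<Longrightarrow>
   runs w m b \<pi> (Order d a l c) (r, M) T Q"
  unfolding runs_def by (meson exec.Order)

lemma runs_Seq:
  "runs w m b \<pi> P st T (\<lambda>st' T'. runs w m b \<pi> P' st' T' Q) \<Longrightarrow> runs w m b \<pi> (Seq P P') st T Q"
  unfolding runs_def
proof (elim exE conjE)
  fix t st' t' st''
  assume "t \<le> T" "exec w m b \<pi> P st t st'" "t' \<le> T - t" "exec w m b \<pi> P' st' t' st''" "Q st'' (T - t - t')"
  then show "\<exists>t st'. t \<le> T \<and> exec w m b \<pi> (Seq P P') st t st' \<and> Q st' (T - t)"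
    by (intro exI[of _ "t + t'"] exI[of _ st'']) (auto intro: exec.Seq)
qed

lemma runs_SeqI:
  assumes "runs w m b \<pi> P st T R" "\<And>r M U. R (r, M) U \<Longrightarrow> runs w m b \<pi> P' (r, M) U Q"
  shows "runs w m b \<pi> (Seq P P') st T Q"
proof (rule runs_Seq)
  show "runs w m b \<pi> P st T (\<lambda>st' T'. runs w m b \<pi> P' st' T' Q)"
    using assms unfolding runs_def[of w m b \<pi> P] by (metis surj_pair)
qed

lemma runs_If:
  assumes "1 \<le> T" "r x \<noteq> 0 \<Longrightarrow> runs w m b \<pi> P (r, M) (T - 1) Q"
    "r x = 0 \<Longrightarrow> runs w m b \<pi> P' (r, M) (T - 1) Q"
  shows "runs w m b \<pi> (IfNZ x P P') (r, M) T Q"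
proof -
  obtain t st' where "t \<le> T - 1" "exec w m b \<pi> (IfNZ x P P') (r, M) (1 + t) st'" "Q st' (T - 1 - t)"
    using assms exec.IfTrue[of r x w m b \<pi> P M _ _ P'] exec.IfFalse[of r x w m b \<pi> P' M _ _ P]
    unfolding runs_def by (cases "r x = 0") blast+
  then show ?thesis using assms(1) unfolding runs_def
    by (intro exI[of _ "1 + t"] exI[of _ st']) auto
qed

text \<open>The invariant may mention the remaining time, which doubles as the termination measure.\<close>

lemma runs_While:
  assumes "Inv st T"
    and "\<And>r M T. Inv (r, M) T \<Longrightarrow>
      1 \<le> T \<and> (if r x \<noteq> 0 then runs w m b \<pi> P (r, M) (T - 1) Inv else Q (r, M) (T - 1))"
  shows "runs w m b \<pi> (WhileNZ x P) st T Q"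
  using assms(1)
proof (induction T arbitrary: st rule: less_induct)
  case (less T)
  obtain r M where st: "st = (r, M)" by (cases st)
  have step: "1 \<le> T" "if r x \<noteq> 0 then runs w m b \<pi> P (r, M) (T - 1) Inv else Q (r, M) (T - 1)"
    using assms(2)[of r M T] less.prems unfolding st by blast+
  show ?case
  proof (cases "r x = 0")
    case True
    then show ?thesis using step exec.WhileFalse[of r x w m b \<pi> P M] unfolding runs_def st by auto
  next
    case False
    then obtain t st' where t: "t \<le> T - 1" "exec w m b \<pi> P (r, M) t st'" "Inv st' (T - 1 - t)"
      using step by (auto simp: runs_def)
    then obtain t' st'' where t': "t' \<le> T - 1 - t" "exec w m b \<pi> (WhileNZ x P) st' t' st''"
      "Q st'' (T - 1 - t - t')"
      using less.IH[of "T - 1 - t" st'] step(1) by (auto simp: runs_def)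
    show ?thesis unfolding runs_def st
      using exec.WhileTrue[OF False t(2) t'(2)] t t' step(1)
      by (intro exI[of _ "1 + t + t'"] exI[of _ st'']) auto
  qed
qed

lemma runs_WhileI:
  assumes "Inv st T" "\<And>r M T. Inv (r, M) T \<Longrightarrow> 1 \<le> T"
    and "\<And>r M T. Inv (r, M) T \<Longrightarrow> r x \<noteq> 0 \<Longrightarrow> runs w m b \<pi> P (r, M) (T - 1) Inv"
    and "\<And>r M T. Inv (r, M) T \<Longrightarrow> r x = 0 \<Longrightarrow> Q (r, M) (T - 1)"
  shows "runs w m b \<pi> (WhileNZ x P) st T Q"
  by (rule runs_While[of Inv]) (use assms in auto)

lemma runs_mono:
  "runs w m b \<pi> P st T Q \<Longrightarrow> (\<And>r M U. Q (r, M) U \<Longrightarrow> Q' (r, M) U) \<Longrightarrow> runs w m b \<pi> P st T Q'"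
  unfolding runs_def by (metis surj_pair)

section \<open>The inversion program\<close>

abbreviation seq :: "prog \<Rightarrow> prog \<Rightarrow> prog" (infixr ";;" 60) where "P ;; Q \<equiv> Seq P Q"

text \<open>Memory, with \<open>n = |s|\<close>: the word being spelled, later the output, at \<open>0\<close>; the array of
  predecessor blocks at \<open>n\<close>; for the \<open>k\<close>-th word of the queue its first symbol at \<open>2n + k\<close>, the index of
  its tail at \<open>3n + k\<close>, its row interval at \<open>4n + k\<close> and \<open>5n + k\<close>; the inverse of the current ordering
  at \<open>6n\<close>; the lower and upper ends of the row intervals of the one-symbol extensions, indexed by
  \<open>k\<sigma> + c\<close>, at \<open>6n + \<sigma>\<close> and \<open>6n + \<sigma> + n\<sigma>\<close>.  Registers 3 to 11 hold these offsets and the constants 1 and 0.\<close>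

abbreviation (input) "rLen \<equiv> 0 :: nat"
abbreviation (input) "rSig \<equiv> 1 :: nat"
abbreviation (input) "rRow \<equiv> 2 :: nat"
abbreviation (input) "rOne \<equiv> 3 :: nat"
abbreviation (input) "rZero \<equiv> 4 :: nat"
abbreviation (input) "rHead \<equiv> 5 :: nat"
abbreviation (input) "rTail \<equiv> 6 :: nat"
abbreviation (input) "rNlo \<equiv> 7 :: nat"
abbreviation (input) "rNhi \<equiv> 8 :: nat"
abbreviation (input) "rInv \<equiv> 9 :: nat"
abbreviation (input) "rClo \<equiv> 10 :: nat"
abbreviation (input) "rChi \<equiv> 11 :: nat"
abbreviation (input) "rV \<equiv> 12 :: nat"
abbreviation (input) "rYlo \<equiv> 13 :: nat"
abbreviation (input) "rYhi \<equiv> 14 :: nat"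
abbreviation (input) "rC \<equiv> 15 :: nat"
abbreviation (input) "rP \<equiv> 16 :: nat"
abbreviation (input) "rHi \<equiv> 17 :: nat"
abbreviation (input) "rA \<equiv> 18 :: nat"
abbreviation (input) "rN \<equiv> 20 :: nat"
abbreviation (input) "rAcc \<equiv> 21 :: nat"
abbreviation (input) "rAdr \<equiv> 22 :: nat"
abbreviation (input) "rCond \<equiv> 23 :: nat"
abbreviation (input) "rK \<equiv> 24 :: nat"
abbreviation (input) "rL \<equiv> 25 :: nat"
abbreviation (input) "rD \<equiv> 26 :: nat"
abbreviation (input) "rT \<equiv> 27 :: nat"
abbreviation (input) "rFrom \<equiv> 28 :: nat"
abbreviation (input) "rTo \<equiv> 29 :: nat"
abbreviation (input) "rE \<equiv> 30 :: nat"
abbreviation (input) "rQ \<equiv> 31 :: nat"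
abbreviation (input) "rX \<equiv> 32 :: nat"
abbreviation (input) "rY \<equiv> 33 :: nat"

definition "get d base k = (Op Add rAdr base k ;; Load d rAdr)"
definition "put base k x = (Op Add rAdr base k ;; Store rAdr x)"
definition "get2 d base k c =
  (Op Mul rAdr k rSig ;; Op Add rAdr rAdr c ;; Op Add rAdr base rAdr ;; Load d rAdr)"
definition "put2 base k c x =
  (Op Mul rAdr k rSig ;; Op Add rAdr rAdr c ;; Op Add rAdr base rAdr ;; Store rAdr x)"

text \<open>Following the tail links down to index 0, the empty word, yields the symbols from left
  to right, in the form in which \<open>Order\<close> expects them.\<close>

definition "spell_step = (get rE rHead rK ;; Store rL rE ;; Op Add rL rL rOne ;; get rK rTail rK)"
definition "spell = (Op Add rK rN rZero ;; Const rL 0 ;; WhileNZ rK spell_step)"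

text \<open>\<open>Order\<close> answers for a symbol, but the children are laid out by position, so
  the inverse is tabulated first.\<close>

definition "orders_step =
  (Order rX rZero rL rD ;; put rInv rX rD ;; Op Add rD rD rOne ;; Op Less rCond rD rSig)"
definition "orders = (Const rD 0 ;; Op Less rCond rD rSig ;; WhileNZ rCond orders_step)"

text \<open>For \<open>x = ay\<close> the word \<open>xd\<close> is \<open>a\<close> in front of
  \<open>yd\<close>, whose interval is in the tables; for the root it is \<open>d\<close> in front
  of the empty word, whose interval is all of the matrix.\<close>

definition "source =
  IfNZ rN (get2 rFrom rClo rV rD ;; get2 rTo rChi rV rD ;; Op Add rE rA rZero)
    (Const rFrom 0 ;; Op Add rTo rLen rZero ;; Op Add rE rD rZero)"

text \<open>Ranks give the number of hits but not their rows. Visiting the rows one by one costs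
  \<open>O(n)\<close> per symbol, the same order as one call of \<open>Order\<close>.
  \<open>Const rX 0\<close> serves as an empty else branch.\<close>

definition "scan_step =
  (Bwt rX rQ ;; Op Eq rX rX rE ;; IfNZ rX (put rLen rQ rAcc) (Const rX 0) ;;
   Op Add rQ rQ rOne ;; Op Less rCond rQ rTo)"
definition "scan = (Op Add rQ rFrom rZero ;; Op Less rCond rQ rTo ;; WhileNZ rCond scan_step)"

text \<open>\<open>rAcc\<close> enters as the lower end of the child and leaves as its upper end,
  which is the lower end of the next child. The larger rank is added before the smaller one is
  subtracted, so the register never underflows.\<close>

definition "child =
  (source ;; put2 rClo rN rD rAcc ;; scan ;;
   Rank rX rE rTo ;; Op Add rAcc rAcc rX ;; Rank rX rE rFrom ;; Op Sub rAcc rAcc rX ;;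
   put2 rChi rN rD rAcc)"

definition "layout_step = (get rD rInv rT ;; child ;; Op Add rT rT rOne ;; Op Less rCond rT rSig)"
definition "layout = (Const rT 0 ;; Op Less rCond rT rSig ;; WhileNZ rCond layout_step)"

definition "new_links = (put rHead rN rA ;; put rTail rN rV ;; put rNlo rN rAcc)"
definition "new_node =
  (new_links ;; spell ;; orders ;; layout ;; put rNhi rN rAcc ;; Op Add rN rN rOne)"

text \<open>The word \<open>ay\<close> is new and branching iff row \<open>p\<close> carries the first \<open>a\<close> in the interval of \<open>y\<close>
  and another \<open>a\<close> occurs after the interval of \<open>yc\<close>, where row \<open>p\<close> starts with \<open>yc\<close>.\<close>

definition "visit_test =
  (Bwt rA rP ;; Rank rX rA rP ;; Rank rY rA rYlo ;; Op Eq rX rX rY ;;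
   Rank rY rA rHi ;; Rank rE rA rYhi ;; Op Less rY rY rE ;; Op Mul rX rX rY)"
text \<open>On a hit the predecessor array at row \<open>p\<close> holds \<open>lo (a # y)\<close>,
  which is where the layout of the new word has to start.\<close>

definition "visit =
  (visit_test ;; IfNZ rX (get rAcc rLen rP ;; new_node) (Const rX 0))"

definition "visit_step = (visit ;; Op Add rP rP rOne ;; Op Less rCond rP rHi)"
definition "visit_child =
  (get2 rP rClo rV rC ;; get2 rHi rChi rV rC ;; Op Less rCond rP rHi ;; WhileNZ rCond visit_step)"

definition "visit_child_step = (visit_child ;; Op Add rC rC rOne ;; Op Less rCond rC rSig)"
definition "visit_node =
  (get rYlo rNlo rV ;; get rYhi rNhi rV ;; Const rC 0 ;; Op Less rCond rC rSig ;;
   WhileNZ rCond visit_child_step)"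

definition "search_step = (visit_node ;; Op Add rV rV rOne ;; Op Less rCond rV rN)"
definition "search = (Op Less rCond rV rN ;; WhileNZ rCond search_step)"

definition "init_regs =
  (Const rOne 1 ;; Op Add rHead rLen rLen ;; Op Add rTail rHead rLen ;; Op Add rNlo rTail rLen ;;
   Op Add rNhi rNlo rLen ;; Op Add rInv rNhi rLen ;; Op Add rClo rInv rSig ;;
   Op Mul rX rLen rSig ;; Op Add rChi rClo rX)"

definition "read_off_step = (Op Sub rK rK rOne ;; Bwt rX rP ;; Store rK rX ;; get rP rLen rP)"
definition "read_off = (Op Add rP rRow rZero ;; Op Add rK rLen rZero ;; WhileNZ rK read_off_step)"

definition "invert_bwt = (init_regs ;; new_node ;; search ;; read_off)"

section \<open>Correctness and running time\<close>

locale ram_instance = ctx_bwt_instance +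
  fixes w :: nat
  assumes word_size: "16 * \<sigma> * n \<le> 2 ^ w"
begin

section \<open>Memory size, and instructions that do not wrap around\<close>

definition mem :: nat where "mem = 16 * \<sigma> * n"
definition area :: nat where "area = n * \<sigma>"

abbreviation "rn \<equiv> runs w mem b \<pi>"

lemma sigma_pos: "0 < \<sigma>"
  using b_less[of 0] n_pos by simp

text \<open>The tables end at \<open>6 * n + \<sigma> + 2 * area\<close>, hence within
  \<open>9 * area\<close>; the rest of the factor 16 makes every bound needed for addresses and
  counters a matter of linear arithmetic.\<close>

lemma sizes: "n \<le> area" "\<sigma> \<le> area" "16 * area \<le> mem" "mem \<le> 2 ^ w" "0 < n" "0 < \<sigma>"
  using word_size n_pos sigma_pos by (auto simp: ac_simps area_def mem_def)

lemma bounded: "x < mem \<Longrightarrow> x < 2 ^ w"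
  using sizes by simp

lemma index_bound: "k < N \<Longrightarrow> c < \<sigma> \<Longrightarrow> k * \<sigma> + c < N * \<sigma>"
proof -
  assume "k < N" "c < \<sigma>"
  then have "k * \<sigma> + c < Suc k * \<sigma>" by simp
  also have "\<dots> \<le> N * \<sigma>" using \<open>k < N\<close> by (intro mult_right_mono) auto
  finally show ?thesis .
qed

lemma index_area: "k < n \<Longrightarrow> c < \<sigma> \<Longrightarrow> k * \<sigma> + c < area"
  unfolding area_def by (rule index_bound)

lemma rn_Add:
  "1 \<le> T \<Longrightarrow> r x + r y < mem \<Longrightarrow> Q (r(d := r x + r y), M) (T - 1) \<Longrightarrow>
   rn (Op Add d x y) (r, M) T Q"
  using runs_Op[of T Q r d w Add x y M] bounded by simp

lemma rn_Mul:
  "1 \<le> T \<Longrightarrow> r x * r y < mem \<Longrightarrow> Q (r(d := r x * r y), M) (T - 1) \<Longrightarrow>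
   rn (Op Mul d x y) (r, M) T Q"
  using runs_Op[of T Q r d w Mul x y M] bounded by simp

lemma rn_Sub:
  assumes "1 \<le> T" "r y \<le> r x" "r x < mem" "Q (r(d := r x - r y), M) (T - 1)"
  shows "rn (Op Sub d x y) (r, M) T Q"
proof -
  have "(r x + 2 ^ w - r y) mod 2 ^ w = (r x - r y + 2 ^ w) mod 2 ^ w"
    using assms(2) by simp
  also have "\<dots> = r x - r y"
    using bounded[OF assms(3)] by simp
  finally show ?thesis using runs_Op[of T Q r d w Sub x y M] assms by simp
qed

lemma w_pos: "0 < w"
proof (rule gr0I)
  assume "w = 0"
  then have "mem \<le> 1" using sizes(4) by simp
  then show False using sizes by linarith
qed

lemma rn_Less:
  "1 \<le> T \<Longrightarrow> Q (r(d := of_bool (r x < r y)), M) (T - 1) \<Longrightarrow> rn (Op Less d x y) (r, M) T Q"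
  using runs_Op[of T Q r d w Less x y M] w_pos by (cases "r x < r y") simp_all

lemma rn_Eq:
  "1 \<le> T \<Longrightarrow> Q (r(d := of_bool (r x = r y)), M) (T - 1) \<Longrightarrow> rn (Op Eq d x y) (r, M) T Q"
  using runs_Op[of T Q r d w Eq x y M] w_pos by (cases "r x = r y") simp_all

lemma small: "n < 2 ^ w" "\<sigma> < 2 ^ w"
  using sizes by linarith+

lemma rn_Const:
  "1 \<le> T \<Longrightarrow> k \<le> 1 \<Longrightarrow> Q (r(d := k), M) (T - 1) \<Longrightarrow> rn (Const d k) (r, M) T Q"
  using runs_Const[of T Q r d k w M] small n_pos by simp

lemma rn_Bwt:
  "1 \<le> T \<Longrightarrow> r j < n \<Longrightarrow> Q (r(d := b ! r j), M) (T - 1) \<Longrightarrow> rn (Bwt d j) (r, M) T Q"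
  using runs_Bwt[of T r j b Q d w M] b_less[of "r j"] small by (simp add: b_length)

lemma rank_le: "j \<le> n \<Longrightarrow> rank b c j \<le> n"
  unfolding rank_def using count_le_length[of "take j b" c] by (simp add: b_length)

lemma rn_Rank:
  "1 \<le> T \<Longrightarrow> r j \<le> n \<Longrightarrow> Q (r(d := rank b (r c) (r j)), M) (T - 1) \<Longrightarrow> rn (Rank d c j) (r, M) T Q"
  using runs_Rank[of T r j b Q d c w M] rank_le[of "r j" "r c"] small by (simp add: b_length)

lemma rn_get:
  assumes "2 \<le> T" "r base + r k < mem"
    "Q (r(rAdr := r base + r k, d := M (r base + r k)), M) (T - 2)"
  shows "rn (get d base k) (r, M) T Q"
  unfolding get_def using assms
  by (intro runs_Seq rn_Add runs_Load) (auto simp: numeral_2_eq_2)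

lemma rn_put:
  assumes "2 \<le> T" "r base + r k < mem" "x \<noteq> rAdr"
    "Q (r(rAdr := r base + r k), M(r base + r k := r x)) (T - 2)"
  shows "rn (put base k x) (r, M) T Q"
  unfolding put_def using assms
  by (intro runs_Seq rn_Add runs_Store) (auto simp: numeral_2_eq_2)

lemma rn_get2:
  assumes "4 \<le> T" "r base + (r k * r rSig + r c) < mem" "c \<noteq> rAdr" "base \<noteq> rAdr"
    "Q (r(rAdr := r base + (r k * r rSig + r c), d := M (r base + (r k * r rSig + r c))), M) (T - 4)"
  shows "rn (get2 d base k c) (r, M) T Q"
  unfolding get2_def using assms
  by (intro runs_Seq rn_Add rn_Mul runs_Load) (auto simp: eval_nat_numeral)

lemma rn_put2:
  assumes "4 \<le> T" "r base + (r k * r rSig + r c) < mem" "c \<noteq> rAdr" "base \<noteq> rAdr" "x \<noteq> rAdr"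
    "Q (r(rAdr := r base + (r k * r rSig + r c)), M(r base + (r k * r rSig + r c) := r x)) (T - 4)"
  shows "rn (put2 base k c x) (r, M) T Q"
  unfolding put2_def using assms
  by (intro runs_Seq rn_Add rn_Mul runs_Store) (auto simp: eval_nat_numeral)

lemmas vcg = runs_Seq rn_Add rn_Mul rn_Sub rn_Less rn_Eq rn_Const rn_Bwt rn_Rank rn_get rn_put
  rn_get2 rn_put2 runs_Load runs_Store

definition fixed_regs :: "(nat \<Rightarrow> nat) \<Rightarrow> bool" where
  "fixed_regs r \<longleftrightarrow> r rLen = n \<and> r rSig = \<sigma> \<and> r rOne = 1 \<and> r rZero = 0 \<and> r rHead = 2 * n \<and>
     r rTail = 3 * n \<and> r rNlo = 4 * n \<and> r rNhi = 5 * n \<and> r rInv = 6 * n \<and> r rClo = 6 * n + \<sigma> \<and>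
     r rChi = 6 * n + \<sigma> + area"

lemma fixed_regs_frame: "fixed_regs r \<Longrightarrow> (\<And>k. k < 12 \<Longrightarrow> r' k = r k) \<Longrightarrow> fixed_regs r'"
  by (simp add: fixed_regs_def)

lemma fixed_regsD:
  assumes "fixed_regs r"
  shows "r rLen = n" "r rSig = \<sigma>" "r (Suc 0) = \<sigma>" "r rOne = 1" "r rZero = 0" "r rHead = 2 * n"
    "r rTail = 3 * n" "r rNlo = 4 * n" "r rNhi = 5 * n" "r rInv = 6 * n" "r rClo = 6 * n + \<sigma>"
    "r rChi = 6 * n + \<sigma> + area"
  using assms by (auto simp: fixed_regs_def)

section \<open>The loops that lay out one word\<close>

lemma runs_scan:
  assumes c: "fixed_regs r" and to: "r rFrom \<le> r rTo" "r rTo \<le> n" and T: "10 * n + 3 \<le> T"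
  shows "rn scan (r, M) T (\<lambda>(r', M') U. T \<le> U + (10 * n + 3) \<and>
    (\<forall>k. k \<notin> {rAdr, rCond, rQ, rX} \<longrightarrow> r' k = r k) \<and>
    M' = (\<lambda>d. if n \<le> d \<and> d < 2 * n \<and> r rFrom \<le> d - n \<and> d - n < r rTo \<and> b ! (d - n) = r rE
               then r rAcc else M d))"
proof -
  define A where "A = (\<lambda>q d. if n \<le> d \<and> d < 2 * n \<and> r rFrom \<le> d - n \<and> d - n < q \<and> b ! (d - n) = r rE
               then r rAcc else M d)"
  \<comment> \<open>Each scanned row is charged 10, although a pass costs 8; the summand 2 is the
    set-up before the loop.\<close>
  let ?Inv = "\<lambda>(r', M') U. T + 10 * r rFrom \<le> U + 2 + 10 * r' rQ \<and> r rFrom \<le> r' rQ \<and>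
    r' rCond = of_bool (r' rQ < r rTo) \<and> r' rQ \<le> r rTo \<and>
    (\<forall>k. k \<notin> {rAdr, rCond, rQ, rX} \<longrightarrow> r' k = r k) \<and> M' = A (r' rQ)"
  have A0: "A (r rFrom) = M" by (auto simp: A_def)
  have A1: "A (Suc q) = (if b ! q = r rE then (A q)(n + q := r rAcc) else A q)"
    if "r rFrom \<le> q" "q < n" for q
    using that by (auto simp: A_def fun_eq_iff less_Suc_eq)
  note s = sizes and [simp] = fixed_regsD[OF c]
  have loop: "rn (WhileNZ rCond scan_step) (r', M') U (\<lambda>(r', M') U. T \<le> U + (10 * n + 3) \<and>
    (\<forall>k. k \<notin> {rAdr, rCond, rQ, rX} \<longrightarrow> r' k = r k) \<and> M' = A (r rTo))" if "?Inv (r', M') U" for r' M' U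
    using that
  proof (rule runs_WhileI[where Inv = ?Inv], goal_cases)
    case (1 r' M' U)
    then show ?case using T to by auto
  next
    case (2 r' M' U)
    then have I: "T + 10 * r rFrom \<le> U + 2 + 10 * r' rQ" "r rFrom \<le> r' rQ" "r' rQ < r rTo"
      "M' = A (r' rQ)" and fr: "\<And>k. k \<notin> {rAdr, rCond, rQ, rX} \<Longrightarrow> r' k = r k" by (auto split: if_splits)
    then show ?case
      unfolding scan_step_def using s to T by (intro vcg runs_If) (simp_all add: A1)
  next
    case (3 r' M' U)
    then show ?case using T to by (auto split: if_splits)
  qed
  have A: "(\<lambda>d. if n \<le> d \<and> d < 2 * n \<and> r rFrom \<le> d - n \<and> d - n < r rTo \<and> b ! (d - n) = r rE
      then r rAcc else M d) = A (r rTo)" by (simp add: A_def)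
  show ?thesis
    unfolding scan_def A by (intro vcg loop) (use T to s A0 in simp_all)
qed

lemma runs_spell:
  assumes c: "fixed_regs r" and N: "r rN = N" "N < n" and root: "ws ! 0 = []"
    and links: "\<And>k. 0 < k \<Longrightarrow> k \<le> N \<Longrightarrow> ws ! k = M (2 * n + k) # ws ! M (3 * n + k) \<and> M (3 * n + k) < k"
    and len: "length (ws ! N) < n" and T: "10 * n + 3 \<le> T"
  shows "rn spell (r, M) T (\<lambda>(r', M') U. T \<le> U + (10 * n + 3) \<and>
    (\<forall>k. k \<notin> {rAdr, rK, rL, rE} \<longrightarrow> r' k = r k) \<and> r' rL = length (ws ! N) \<and>
    map M' [0..<length (ws ! N)] = ws ! N \<and> (\<forall>d\<ge>n. M' d = M d))"
    (is "rn spell (r, M) T ?Q")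
proof -
  \<comment> \<open>The part already written, followed by the word at the current index, is
    \<open>ws ! N\<close>. Time is charged to the number of symbols written, which stays below
    \<open>n\<close>.\<close>
  let ?Inv = "\<lambda>(r', M') U. T \<le> U + 2 + 10 * r' rL \<and> r' rK \<le> N \<and>
    map M' [0..<r' rL] @ ws ! r' rK = ws ! N \<and>
    (\<forall>k. k \<notin> {rAdr, rK, rL, rE} \<longrightarrow> r' k = r k) \<and> (\<forall>d\<ge>n. M' d = M d)"
  note s = sizes and [simp] = fixed_regsD[OF c]
  have loop: "rn (WhileNZ rK spell_step) (r', M') U ?Q" if "?Inv (r', M') U" for r' M' U
    using that
  proof (rule runs_WhileI[where Inv = ?Inv], goal_cases)
    case (1 r' M' U)
    then have "length (map M' [0..<r' rL] @ ws ! r' rK) = length (ws ! N)" by simp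
    then have "r' rL < n" using len by simp
    then show ?case using 1 T by auto
  next
    case (2 r' M' U)
    then have I: "T \<le> U + 2 + 10 * r' rL" "0 < r' rK" "r' rK \<le> N"
      "map M' [0..<r' rL] @ ws ! r' rK = ws ! N" "\<And>d. n \<le> d \<Longrightarrow> M' d = M d"
      and fr: "\<And>k. k \<notin> {rAdr, rK, rL, rE} \<Longrightarrow> r' k = r k" by auto
    have "length (map M' [0..<r' rL] @ ws ! r' rK) = length (ws ! N)" using I by simp
    then have l: "r' rL < n" using len by simp
    note lk = links[OF I(2,3)]
    have mp: "map (M'(r' rL := x)) [0..<r' rL] = map M' [0..<r' rL]" for x by simp
    have "ws ! N = (map M' [0..<r' rL] @ [M (2 * n + r' rK)]) @ ws ! M (3 * n + r' rK)"
      using I(4) lk by simp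
    then show ?case
      unfolding spell_step_def using s I fr N T l lk
      by (intro vcg) (simp_all add: mp)
  next
    case (3 r' M' U)
    then have *: "map M' [0..<r' rL] = ws ! N" using root by simp
    then have "r' rL = length (ws ! N)" by (metis length_map length_upt minus_nat.diff_0)
    then show ?case using 3 * T len by auto
  qed
  show ?thesis
    unfolding spell_def by (intro vcg loop) (use T s N in simp_all)
qed

lemma rn_Order:
  assumes "1 + r l \<le> T" "r a + r l \<le> mem" "map M [r a..<r a + r l] = x" "set x \<subseteq> {..<\<sigma>}" "r c < \<sigma>"
    "Q (r(d := \<pi> x (r c)), M) (T - (1 + r l))"
  shows "rn (Order d a l c) (r, M) T Q"
proof -
  have "\<pi> x (r c) < \<sigma>" using permutes_in_image[OF order_permutes[OF assms(4)], of "r c"] assms(5) by simp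
  then have "\<pi> x (r c) mod 2 ^ w = \<pi> x (r c)" using small by simp
  then show ?thesis using assms by (intro runs_Order) auto
qed

lemma runs_orders:
  assumes c: "fixed_regs r" and x: "r rL = length x" "map M [0..<length x] = x" "length x < n"
    "set x \<subseteq> {..<\<sigma>}" and T: "\<sigma> * (n + 10) + 3 \<le> T"
  shows "rn orders (r, M) T (\<lambda>(r', M') U. T \<le> U + (\<sigma> * (n + 10) + 3) \<and>
    (\<forall>k. k \<notin> {rAdr, rCond, rD, rX} \<longrightarrow> r' k = r k) \<and>
    (\<forall>t<\<sigma>. M' (6 * n + t) = inv (\<pi> x) t) \<and>
    (\<forall>d. d < 6 * n \<or> 6 * n + \<sigma> \<le> d \<longrightarrow> M' d = M d))"
    (is "rn orders (r, M) T ?Q")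
proof -
  \<comment> \<open>A pass is charged \<open>n + 10\<close> because the query in it costs
    \<open>1 + length x\<close>, which is at most \<open>n\<close>.\<close>
  let ?Inv = "\<lambda>(r', M') U. T \<le> U + 2 + r' rD * (n + 10) \<and> r' rD \<le> \<sigma> \<and>
    r' rCond = of_bool (r' rD < \<sigma>) \<and>
    (\<forall>k. k \<notin> {rAdr, rCond, rD, rX} \<longrightarrow> r' k = r k) \<and>
    (\<forall>c<r' rD. M' (6 * n + \<pi> x c) = c) \<and>
    (\<forall>d. d < 6 * n \<or> 6 * n + \<sigma> \<le> d \<longrightarrow> M' d = M d)"
  note s = sizes and [simp] = fixed_regsD[OF c]
  note perm = order_permutes[OF x(4)]
  have pl: "\<pi> x c < \<sigma>" if "c < \<sigma>" for c using permutes_in_image[OF perm, of c] that by simp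
  have inj: "\<pi> x c = \<pi> x d \<longleftrightarrow> c = d" for c d using permutes_inj[OF perm] by (auto dest: injD)
  have loop: "rn (WhileNZ rCond orders_step) (r', M') U ?Q" if "?Inv (r', M') U" for r' M' U
    using that
  proof (rule runs_WhileI[where Inv = ?Inv], goal_cases)
    case (1 r' M' U)
    then have "r' rD * (n + 10) \<le> \<sigma> * (n + 10)" by (intro mult_right_mono) auto
    moreover have "T \<le> U + 2 + r' rD * (n + 10)" using 1 by simp
    ultimately show ?case using T by linarith
  next
    case (2 r' M' U)
    then have I: "T \<le> U + 2 + r' rD * (n + 10)" "r' rD < \<sigma>"
      "\<And>c. c < r' rD \<Longrightarrow> M' (6 * n + \<pi> x c) = c"
      "\<And>d. d < 6 * n \<or> 6 * n + \<sigma> \<le> d \<Longrightarrow> M' d = M d"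
      and fr: "\<And>k. k \<notin> {rAdr, rCond, rD, rX} \<Longrightarrow> r' k = r k" by (auto split: if_splits)
    have D: "Suc (r' rD) * (n + 10) \<le> \<sigma> * (n + 10)" using I by (intro mult_right_mono) auto
    have "map M' [0..<length x] = map M [0..<length x]" using I(4) x(3) by simp
    then have mp: "map M' [r' rZero..<r' rZero + r' rL] = x" using fr x by simp
    show ?case
      unfolding orders_step_def
      using s I fr T D x pl[OF I(2)] mp
      by (intro vcg rn_Order[where x = x]) (simp_all add: inj less_Suc_eq)
  next
    case (3 r' M' U)
    then have D: "r' rD = \<sigma>" by (auto split: if_splits)
    have "M' (6 * n + t) = inv (\<pi> x) t" if "t < \<sigma>" for t
    proof -
      have "inv (\<pi> x) t < \<sigma>" using permutes_in_image[OF permutes_inv[OF perm], of t] that by simp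
      then have "M' (6 * n + \<pi> x (inv (\<pi> x) t)) = inv (\<pi> x) t" using 3 D by auto
      then show ?thesis by (simp add: permutes_inverses[OF perm])
    qed
    then show ?case using 3 D T by auto
  qed
  show ?thesis
    unfolding orders_def by (intro vcg loop) (use T s in simp_all)
qed

text \<open>\<open>cl\<close>, \<open>ch\<close> and \<open>e\<close> stand for the interval and the
  symbol selected by \<open>source\<close>, so that the root and the inner words share one
  specification.\<close>

lemma runs_child:
  assumes c: "fixed_regs r" and N: "r rN = N" "N < n" and D: "r rD = D" "D < \<sigma>" and acc: "r rAcc \<le> n"
    and src: "N = 0 \<Longrightarrow> cl = 0 \<and> ch = n \<and> e = D"
      "N \<noteq> 0 \<Longrightarrow> r rV < N \<and> cl = M (6 * n + \<sigma> + (r rV * \<sigma> + D)) \<and>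
         ch = M (6 * n + \<sigma> + area + (r rV * \<sigma> + D)) \<and> e = r rA \<and> e < \<sigma>"
    and le: "cl \<le> ch" "ch \<le> n" and T: "10 * n + 40 \<le> T"
  defines "acc' \<equiv> r rAcc + (rank b e ch - rank b e cl)"
  shows "rn child (r, M) T (\<lambda>(r', M') U. T \<le> U + (10 * n + 40) \<and>
    (\<forall>k. k \<notin> {rAcc, rAdr, rCond, rFrom, rTo, rE, rQ, rX} \<longrightarrow> r' k = r k) \<and> r' rAcc = acc' \<and>
    M' = (\<lambda>d. if d = 6 * n + \<sigma> + (N * \<sigma> + D) then r rAcc
              else if d = 6 * n + \<sigma> + area + (N * \<sigma> + D) then acc'
              else if n \<le> d \<and> d < 2 * n \<and> cl \<le> d - n \<and> d - n < ch \<and> b ! (d - n) = e then r rAcc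
              else M d))"
proof -
  note s = sizes and [simp] = fixed_regsD[OF c] N(1) D(1)
  have idx: "N * \<sigma> + D < area" "r rV < N \<Longrightarrow> r rV * \<sigma> + D < area"
    using index_area[of N D] index_area[of "r rV" D] N D by auto
  have idx0: "N * \<sigma> < area" "r rV < N \<Longrightarrow> r rV * \<sigma> < area"
    using idx by linarith+
  have rk: "rank b e cl \<le> rank b e ch" "rank b e ch \<le> n"
    using rank_diff[OF le(1), of b e] le rank_le[of ch e] by (simp_all add: b_length)
  let ?S = "\<lambda>(r', M') U. T \<le> U + 12 \<and> M' = M \<and> r' rFrom = cl \<and> r' rTo = ch \<and>
      r' rE = e \<and> (\<forall>k. k \<notin> {rAdr, rFrom, rTo, rE} \<longrightarrow> r' k = r k)"
  have source: "rn source (r, M) T ?S"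
  proof (cases "N = 0")
    case True
    then show ?thesis using T s src(1) D unfolding source_def by (intro vcg runs_If) simp_all
  next
    case False
    then show ?thesis using T s src(2) D idx idx0 unfolding source_def
      by (intro vcg runs_If) (simp_all add: area_def[symmetric])
  qed
  show ?thesis
    unfolding child_def
  proof (rule runs_SeqI[OF source])
    fix r1 M1 U1 assume S: "?S (r1, M1) U1"
    then have fr1: "\<And>k. k \<notin> {rAdr, rFrom, rTo, rE} \<Longrightarrow> r1 k = r k" by auto
    have f1: "fixed_regs r1" using fixed_regs_frame[OF c, of r1] fr1 by simp
    define r2 where "r2 = r1(rAdr := 6 * n + \<sigma> + (N * \<sigma> + D))"
    define M2 where "M2 = M(6 * n + \<sigma> + (N * \<sigma> + D) := r rAcc)"
    have f2: "fixed_regs r2" using fixed_regs_frame[OF f1, of r2] by (simp add: r2_def)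
    have r2: "r2 rFrom = cl" "r2 rTo = ch" "r2 rE = e" "r2 rAcc = r rAcc"
      "\<And>k. k \<notin> {rAdr, rFrom, rTo, rE} \<Longrightarrow> r2 k = r k"
      using S fr1 by (auto simp: r2_def)
    let ?S2 = "\<lambda>(r', M') U. r' = r2 \<and> M' = M2 \<and> T \<le> U + 16"
    have put: "rn (put2 rClo rN rD rAcc) (r1, M1) U1 ?S2"
      using S T s idx idx0 fr1 by (intro vcg) (simp_all add: fixed_regsD[OF f1] r2_def M2_def)
    show "rn (put2 rClo rN rD rAcc ;; scan ;; Rank rX rE rTo ;; Op Add rAcc rAcc rX ;;
        Rank rX rE rFrom ;; Op Sub rAcc rAcc rX ;; put2 rChi rN rD rAcc) (r1, M1) U1
      (\<lambda>(r', M') U. T \<le> U + (10 * n + 40) \<and>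
        (\<forall>k. k \<notin> {rAcc, rAdr, rCond, rFrom, rTo, rE, rQ, rX} \<longrightarrow> r' k = r k) \<and> r' rAcc = acc' \<and>
        M' = (\<lambda>d. if d = 6 * n + \<sigma> + (N * \<sigma> + D) then r rAcc
              else if d = 6 * n + \<sigma> + area + (N * \<sigma> + D) then acc'
              else if n \<le> d \<and> d < 2 * n \<and> cl \<le> d - n \<and> d - n < ch \<and> b ! (d - n) = e then r rAcc
              else M d))" (is "rn _ _ _ ?Q")
    proof (rule runs_SeqI[OF put])
      fix r' M' U2 assume "?S2 (r', M') U2"
      then have [simp]: "r' = r2" "M' = M2" and T2: "T \<le> U2 + 16" by auto
      let ?S3 = "\<lambda>(r', M') U. U2 \<le> U + (10 * n + 3) \<and>
        (\<forall>k. k \<notin> {rAdr, rCond, rQ, rX} \<longrightarrow> r' k = r2 k) \<and>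
        M' = (\<lambda>d. if n \<le> d \<and> d < 2 * n \<and> cl \<le> d - n \<and> d - n < ch \<and> b ! (d - n) = e
               then r rAcc else M2 d)"
      have scan: "rn scan (r2, M2) U2 ?S3"
        using runs_scan[OF f2, of U2 M2, unfolded r2(1-4)] le T T2 by simp
      show "rn (scan ;; Rank rX rE rTo ;; Op Add rAcc rAcc rX ;;
        Rank rX rE rFrom ;; Op Sub rAcc rAcc rX ;; put2 rChi rN rD rAcc) (r', M') U2 ?Q"
        unfolding \<open>r' = r2\<close> \<open>M' = M2\<close>
      proof (rule runs_SeqI[OF scan])
        fix r3 M3 U3 assume S3: "?S3 (r3, M3) U3"
        then have fr3: "\<And>k. k \<notin> {rAdr, rCond, rQ, rX} \<Longrightarrow> r3 k = r2 k" by auto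
        have f3: "fixed_regs r3" using fixed_regs_frame[OF f2, of r3] fr3 by simp
        have U3: "U2 \<le> U3 + (10 * n + 3)" using S3 by simp
        have A: "r rAcc + rank b e ch - rank b e cl = acc'" using rk by (simp add: acc'_def)
        have M3: "M3(6 * n + \<sigma> + area + (N * \<sigma> + D) := acc') =
          (\<lambda>d. if d = 6 * n + \<sigma> + (N * \<sigma> + D) then r rAcc
              else if d = 6 * n + \<sigma> + area + (N * \<sigma> + D) then acc'
              else if n \<le> d \<and> d < 2 * n \<and> cl \<le> d - n \<and> d - n < ch \<and> b ! (d - n) = e then r rAcc
              else M d)"
          using S3 s by (auto simp: M2_def)
        show "rn (Rank rX rE rTo ;; Op Add rAcc rAcc rX ;;
          Rank rX rE rFrom ;; Op Sub rAcc rAcc rX ;; put2 rChi rN rD rAcc) (r3, M3) U3 ?Q"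
          using U3 T T2 s idx idx0 fr3 r2 le rk acc
          by (intro vcg) (simp_all add: fixed_regsD[OF f3] A M3)
      qed
    qed
  qed
qed

lemma runs_layout:
  assumes c: "fixed_regs r" and N: "r rN = N" "N < n" and x: "length x < n" "set x \<subseteq> {..<\<sigma>}"
    and acc: "r rAcc = lo x" and inv: "\<And>t. t < \<sigma> \<Longrightarrow> M (6 * n + t) = inv (\<pi> x) t"
    and root: "\<And>d. N = 0 \<Longrightarrow> d < \<sigma> \<Longrightarrow> cl d = 0 \<and> ch d = n \<and> e d = d"
    and inner: "\<And>d. N \<noteq> 0 \<Longrightarrow> d < \<sigma> \<Longrightarrow> r rV < N \<and> cl d = M (6 * n + \<sigma> + (r rV * \<sigma> + d)) \<and>
         ch d = M (6 * n + \<sigma> + area + (r rV * \<sigma> + d)) \<and> e d = r rA \<and> e d < \<sigma>"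
    and le: "\<And>d. d < \<sigma> \<Longrightarrow> cl d \<le> ch d \<and> ch d \<le> n"
    and rows: "\<And>d p. d < \<sigma> \<Longrightarrow> p < n \<Longrightarrow> cl d \<le> p \<and> p < ch d \<and> b ! p = e d \<longleftrightarrow> lf p \<in> Pre (x @ [d])"
    and cnt: "\<And>d. d < \<sigma> \<Longrightarrow> rank b (e d) (ch d) - rank b (e d) (cl d) = cnt (x @ [d])"
    and T: "\<sigma> * (10 * n + 60) + 3 \<le> T"
  shows "rn layout (r, M) T (\<lambda>(r', M') U. T \<le> U + (\<sigma> * (10 * n + 60) + 3) \<and>
    (\<forall>k. k \<le> 20 \<longrightarrow> r' k = r k) \<and> r' rAcc = hi x \<and>
    (\<forall>d<\<sigma>. M' (6 * n + \<sigma> + (N * \<sigma> + d)) = lo (x @ [d]) \<and>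
            M' (6 * n + \<sigma> + area + (N * \<sigma> + d)) = hi (x @ [d])) \<and>
    (\<forall>p<n. M' (n + p) = (if lf p \<in> Pre x then lo (x @ [row (lf p) ! length x]) else M (n + p))) \<and>
    (\<forall>d. 2 * n \<le> d \<and> d < 6 * n + \<sigma> + N * \<sigma> \<or>
         6 * n + \<sigma> + area \<le> d \<and> d < 6 * n + \<sigma> + area + N * \<sigma> \<longrightarrow> M' d = M d))"
    (is "rn layout (r, M) T ?Q")
proof -
  let ?inv = "inv (\<pi> x)" and ?K = "10 * n + 60"
  \<comment> \<open>Cells that must survive: the links and bounds, the inverse ordering, and the
    table lines of earlier words, among them the parent, from which the source intervals are read
    during the loop.\<close>
  let ?old = "\<lambda>d. 2 * n \<le> d \<and> d < 6 * n + \<sigma> + N * \<sigma> \<or>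
         6 * n + \<sigma> + area \<le> d \<and> d < 6 * n + \<sigma> + area + N * \<sigma>"
  \<comment> \<open>\<open>rT\<close> counts positions in \<open>\<pi> x\<close>: the children at
    these positions have their intervals, \<open>rAcc\<close> is where the next one starts, and the
    array is updated where the predecessor continues \<open>x\<close> with one of their
    symbols.\<close>
  let ?Inv = "\<lambda>(r', M') U. T \<le> U + 2 + r' rT * ?K \<and> r' rT \<le> \<sigma> \<and>
    r' rCond = of_bool (r' rT < \<sigma>) \<and> (\<forall>k. k \<le> 20 \<longrightarrow> r' k = r k) \<and>
    r' rAcc = lo x + (\<Sum>u<r' rT. cnt (x @ [?inv u])) \<and>
    (\<forall>u<r' rT. M' (6 * n + \<sigma> + (N * \<sigma> + ?inv u)) = lo (x @ [?inv u]) \<and>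
            M' (6 * n + \<sigma> + area + (N * \<sigma> + ?inv u)) = hi (x @ [?inv u])) \<and>
    (\<forall>p<n. M' (n + p) = (if lf p \<in> Pre x \<and> \<pi> x (row (lf p) ! length x) < r' rT
        then lo (x @ [row (lf p) ! length x]) else M (n + p))) \<and>
    (\<forall>d. ?old d \<longrightarrow> M' d = M d)"
  note s = sizes and [simp] = fixed_regsD[OF c] N(1)
  note perm = order_permutes[OF x(2)]
  have pl: "\<pi> x c < \<sigma>" if "c < \<sigma>" for c using permutes_in_image[OF perm, of c] that by simp
  have il: "?inv t < \<sigma>" if "t < \<sigma>" for t
    using permutes_in_image[OF permutes_inv[OF perm], of t] that by simp
  have ii: "\<pi> x (?inv t) = t" "?inv (\<pi> x t) = t" for t by (simp_all add: permutes_inverses[OF perm])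
  have injinv: "?inv u = ?inv t \<longleftrightarrow> u = t" for u t by (metis ii(1))
  have loop: "rn (WhileNZ rCond layout_step) (r', M') U ?Q" if "?Inv (r', M') U" for r' M' U
    using that
  proof (rule runs_WhileI[where Inv = ?Inv], goal_cases)
    case (1 r' M' U)
    then have "r' rT * ?K \<le> \<sigma> * ?K" by (intro mult_right_mono) auto
    moreover have "T \<le> U + 2 + r' rT * ?K" using 1 by simp
    ultimately show ?case using T by linarith
  next
    case (2 r' M' U)
    then have I: "T \<le> U + 2 + r' rT * ?K" "r' rT < \<sigma>"
      "r' rAcc = lo x + (\<Sum>u<r' rT. cnt (x @ [?inv u]))"
      "\<And>u. u < r' rT \<Longrightarrow> M' (6 * n + \<sigma> + (N * \<sigma> + ?inv u)) = lo (x @ [?inv u]) \<and>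
            M' (6 * n + \<sigma> + area + (N * \<sigma> + ?inv u)) = hi (x @ [?inv u])"
      "\<And>p. p < n \<Longrightarrow> M' (n + p) = (if lf p \<in> Pre x \<and> \<pi> x (row (lf p) ! length x) < r' rT
        then lo (x @ [row (lf p) ! length x]) else M (n + p))"
      "\<And>d. ?old d \<Longrightarrow> M' d = M d"
      and fr: "\<And>k. k \<le> 20 \<Longrightarrow> r' k = r k" by (auto split: if_splits)
    define t where "t = r' rT"
    define d where "d = ?inv t"
    have t: "t < \<sigma>" and d: "d < \<sigma>" and pd: "\<pi> x d = t"
      using I(2) il ii by (auto simp: t_def d_def)
    have Tt: "Suc t * ?K \<le> \<sigma> * ?K" using t by (intro mult_right_mono) auto
    have acc': "r' rAcc = lo (x @ [d])" using I(3) by (simp add: lo_snoc pd t_def)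
    have accn: "lo (x @ [d]) \<le> n" using lo_hi_le[of "x @ [d]"] x d by simp
    have f': "fixed_regs r'" using fixed_regs_frame[OF c, of r'] fr by simp
    define r2 where "r2 = r'(rAdr := 6 * n + t, rD := d)"
    have r2: "r2 rD = d" "r2 rAcc = lo (x @ [d])" "r2 rT = t" "\<And>k. k \<le> 20 \<Longrightarrow> r2 k = r k"
      using fr acc' by (auto simp: r2_def t_def)
    have f2: "fixed_regs r2" using fixed_regs_frame[OF f', of r2] by (simp add: r2_def)
    let ?S2 = "\<lambda>(r'', M'') U'. r'' = r2 \<and> M'' = M' \<and> U' = U - 3"
    have get: "rn (get rD rInv rT) (r', M') (U - 1) ?S2"
      using I(1,2,6) T Tt s inv[OF t] by (intro vcg) (simp_all add: fixed_regsD[OF f'] t_def d_def r2_def)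
    have idx: "r rV < N \<Longrightarrow> r rV * \<sigma> + d < N * \<sigma>" using index_bound[of "r rV" N d] d by simp
    have NA: "N * \<sigma> + d < area" using index_area[OF N(2) d] .
    let ?S3 = "\<lambda>(r'', M'') V. U \<le> V + (10 * n + 43) \<and>
      (\<forall>k. k \<notin> {rAcc, rAdr, rCond, rFrom, rTo, rE, rQ, rX} \<longrightarrow> r'' k = r2 k) \<and>
      r'' rAcc = hi (x @ [d]) \<and>
      M'' = (\<lambda>a. if a = 6 * n + \<sigma> + (N * \<sigma> + d) then lo (x @ [d])
              else if a = 6 * n + \<sigma> + area + (N * \<sigma> + d) then hi (x @ [d])
              else if n \<le> a \<and> a < 2 * n \<and> cl d \<le> a - n \<and> a - n < ch d \<and> b ! (a - n) = e d
                then lo (x @ [d]) else M' a)"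
    have U: "10 * n + 50 \<le> U" using I(1) T Tt by (simp add: t_def)
    have child: "rn child (r2, M') (U - 3) ?S3"
    proof (rule runs_mono[OF runs_child[OF f2, of N d "cl d" "ch d" "e d" M' "U - 3"]], goal_cases)
      case 7
      then show ?case using inner[OF _ d] r2 idx I(6) NA by auto
    next
      case (11 r'' M'' V)
      then show ?case using r2 cnt[OF d] U by (auto simp: hi_def)
    qed (use r2 N d accn root[OF _ d] le[OF d] U in auto)
    show ?case
      unfolding layout_step_def
    proof (rule runs_SeqI[OF get], rule runs_SeqI)
      fix r'' M'' U' assume "?S2 (r'', M'') U'"
      then show "rn child (r'', M'') U' ?S3" using child by simp
    next
      fix r3 M3 U3 assume S3: "?S3 (r3, M3) U3"
      then have fr3: "\<And>k. k \<notin> {rAcc, rAdr, rCond, rFrom, rTo, rE, rQ, rX} \<Longrightarrow> r3 k = r2 k" by auto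
      have f3: "fixed_regs r3" using fixed_regs_frame[OF f2, of r3] fr3 by simp
      have S3': "U \<le> U3 + (10 * n + 43)" "r3 rAcc = hi (x @ [d])" using S3 by auto
      have A: "M3 (6 * n + \<sigma> + (N * \<sigma> + ?inv u)) = lo (x @ [?inv u]) \<and>
            M3 (6 * n + \<sigma> + area + (N * \<sigma> + ?inv u)) = hi (x @ [?inv u])" if "u < Suc t" for u
      proof (cases "u = t")
        case True
        then show ?thesis using S3 NA by (auto simp: d_def)
      next
        case False
        then have u: "u < t" using that by simp
        have "?inv u \<noteq> d" using False injinv by (simp add: d_def)
        moreover have "?inv u < \<sigma>" using il u t by simp
        ultimately show ?thesis
          using S3 NA index_area[OF N(2), of "?inv u"] I(4)[of u] u s by (auto simp: t_def)
      qed
      have B: "M3 (n + p) = (if lf p \<in> Pre x \<and> \<pi> x (row (lf p) ! length x) < Suc t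
        then lo (x @ [row (lf p) ! length x]) else M (n + p))" if p: "p < n" for p
      proof -
        have key: "row (lf p) ! length x = d \<longleftrightarrow> \<pi> x (row (lf p) ! length x) = t"
          using pd ii(2) by metis
        have "M3 (n + p) = (if cl d \<le> p \<and> p < ch d \<and> b ! p = e d then lo (x @ [d]) else M' (n + p))"
          using S3 p by auto
        also have "\<dots> = (if lf p \<in> Pre (x @ [d]) then lo (x @ [d]) else M' (n + p))"
          using rows[OF d p] by simp
        also have "\<dots> = (if lf p \<in> Pre x \<and> \<pi> x (row (lf p) ! length x) < Suc t
            then lo (x @ [row (lf p) ! length x]) else M (n + p))"
          using I(5)[OF p] x(1) key by (auto simp: Pre_snoc less_Suc_eq t_def[symmetric])
        finally show ?thesis .
      qed
      have C: "M3 a = M a" if "?old a" for a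
        using that S3 NA I(6)[OF that] by auto
      show "rn (Op Add rT rT rOne ;; Op Less rCond rT rSig) (r3, M3) U3 ?Inv"
      proof (intro vcg, goal_cases)
        case 4
        have "lo x + (\<Sum>u<Suc t. cnt (x @ [?inv u])) = hi (x @ [d])"
          by (simp add: hi_def lo_snoc pd d_def ii)
        then show ?case
          using S3' A B C I(1) U r2 fr3 t by (simp add: fixed_regsD[OF f3] t_def[symmetric])
      qed (use S3' U t s fr3 r2 in \<open>simp_all add: fixed_regsD[OF f3]\<close>)
    qed
  next
    case (3 r' M' U)
    then have t: "r' rT = \<sigma>" by (auto split: if_splits)
    have "r' rAcc = hi x" using 3 t sum_cnt_snoc[OF x] by (simp add: hi_def)
    moreover have "M' (6 * n + \<sigma> + (N * \<sigma> + d)) = lo (x @ [d]) \<and>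
            M' (6 * n + \<sigma> + area + (N * \<sigma> + d)) = hi (x @ [d])" if "d < \<sigma>" for d
      using 3 t pl[OF that] ii(2)[of d] by force
    moreover have "M' (n + p) = (if lf p \<in> Pre x then lo (x @ [row (lf p) ! length x]) else M (n + p))"
      if "p < n" for p using 3 t that pl Pre_nth_less[OF _ x(1), of "lf p"] by auto
    ultimately show ?case using 3 t T by auto
  qed
  show ?thesis
    unfolding layout_def by (intro vcg loop) (use T s acc in simp_all)
qed

section \<open>The tables of the queue and the insertion of a word\<close>

definition nodes :: "nat list list \<Rightarrow> (nat \<Rightarrow> nat) \<Rightarrow> bool" where
  "nodes ws M \<longleftrightarrow> (\<forall>k<length ws.
     (0 < k \<longrightarrow> ws ! k = M (2 * n + k) # ws ! M (3 * n + k) \<and> M (3 * n + k) < k) \<and>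
     M (4 * n + k) = lo (ws ! k) \<and> M (5 * n + k) = hi (ws ! k) \<and>
     (\<forall>c<\<sigma>. M (6 * n + \<sigma> + (k * \<sigma> + c)) = lo (ws ! k @ [c]) \<and>
            M (6 * n + \<sigma> + area + (k * \<sigma> + c)) = hi (ws ! k @ [c])))"

lemma rank_cnt:
  assumes "length z < n" "set z \<subseteq> {..<\<sigma>}"
  shows "rank b a (hi z) - rank b a (lo z) = cnt (a # z)"
proof -
  have "Pre z = {lo z..<hi z}" using assms by (intro Pre_interval) auto
  then show ?thesis
    using rank_diff[of "lo z" "hi z" b a] lo_hi_le[of z] assms by (simp add: b_length cnt_Cons)
qed

lemma runs_new_node:
  assumes c: "fixed_regs r" and nd: "nodes ws M" and N: "r rN = length ws" "length ws < n"
    and root: "ws = [] \<Longrightarrow> x = []"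
    and inner: "ws \<noteq> [] \<Longrightarrow> ws ! 0 = [] \<and> r rV < length ws \<and> x = r rA # ws ! r rV \<and> branching x"
    and acc: "r rAcc = lo x" and T: "120 * area \<le> T"
  shows "rn new_node (r, M) T (\<lambda>(r', M') U. T \<le> U + 120 * area \<and>
    (\<forall>k<20. r' k = r k) \<and> r' rN = Suc (length ws) \<and> nodes (ws @ [x]) M' \<and>
    (\<forall>p<n. M' (n + p) = (if lf p \<in> Pre x then lo (x @ [row (lf p) ! length x]) else M (n + p))))"
    (is "rn _ _ _ ?Q")
proof -
  define N where "N = length ws"
  define y where "y = ws ! r rV"
  \<comment> \<open>\<open>x @ [d]\<close> is \<open>e d # z d\<close>, where the interval of
    \<open>z d\<close> is already known: all rows for the root, a table entry of the parent
    otherwise.\<close>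
  define z where "z = (\<lambda>d. if N = 0 then [] else y @ [d])"
  define e where "e = (\<lambda>d. if N = 0 then d else r rA)"
  note s = sizes and [simp] = fixed_regsD[OF c]
  have Nn: "N < n" "r rN = N" using N by (auto simp: N_def)
  have x: "length x < n" "set x \<subseteq> {..<\<sigma>}"
  proof -
    consider "x = []" | "branching x" using root inner by blast
    then show "length x < n" "set x \<subseteq> {..<\<sigma>}"
      using n_pos branching_symbols by (cases; simp add: branching_def)+
  qed
  have Nb: "N * \<sigma> + d < area" if "d < \<sigma>" for d using index_area[OF Nn(1) that] .
  have ze: "x @ [d] = e d # z d" for d
    using root inner by (cases "ws = []") (simp_all add: z_def e_def N_def y_def)
  have z: "length (z d) < n" "set (z d) \<subseteq> {..<\<sigma>}" if "d < \<sigma>" for d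
  proof -
    have "length (e d # z d) \<le> n" "set (e d # z d) \<subseteq> {..<\<sigma>}"
      unfolding ze[symmetric] using x that by auto
    then show "length (z d) < n" "set (z d) \<subseteq> {..<\<sigma>}" by auto
  qed
  define ko where "ko = \<sigma> * (n + 10) + 3"
  define kl where "kl = \<sigma> * (10 * n + 60) + 3"
  \<comment> \<open>As \<open>n\<close>, \<open>\<sigma>\<close> and 1 are at most
    \<open>area\<close>, the sum is at most 106 times \<open>area\<close>. The gap between 115 and
    the 120 of the statement pays for the closing instructions.\<close>
  have K: "kl + ko + (10 * n + 3) + 6 \<le> 115 * area"
  proof -
    have "kl + ko + (10 * n + 3) + 6 = 11 * area + 70 * \<sigma> + 10 * n + 15"
      by (simp add: kl_def ko_def area_def algebra_simps)
    also have "\<dots> \<le> 115 * area" using s(1,2,5,6) by linarith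
    finally show ?thesis .
  qed
  define r1 where "r1 = r(rAdr := 4 * n + N)"
  define M1 where "M1 = M(2 * n + N := r rA, 3 * n + N := r rV, 4 * n + N := lo x)"
  have f1: "fixed_regs r1" using fixed_regs_frame[OF c, of r1] by (simp add: r1_def)
  let ?S1 = "\<lambda>(r', M') U. r' = r1 \<and> M' = M1 \<and> T \<le> U + 6"
  have start: "rn new_links (r, M) T ?S1"
    unfolding new_links_def using T s Nn acc by (intro vcg) (simp_all add: r1_def M1_def fun_upd_twist)
  let ?S2 = "\<lambda>(r', M') U. T \<le> U + (6 + (10 * n + 3)) \<and>
    (\<forall>k. k \<notin> {rAdr, rK, rL, rE} \<longrightarrow> r' k = r1 k) \<and> r' rL = length x \<and>
    map M' [0..<length x] = x \<and> (\<forall>d\<ge>n. M' d = M1 d)"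
  have spell: "rn spell (r1, M1) U ?S2" if "T \<le> U + 6" for U
  proof -
    have links: "(ws @ [x]) ! k = M1 (2 * n + k) # (ws @ [x]) ! M1 (3 * n + k) \<and> M1 (3 * n + k) < k"
      if "0 < k" "k \<le> N" for k
    proof (cases "k = N")
      case True
      then have "ws \<noteq> []" using that by (auto simp: N_def)
      then show ?thesis using True inner s Nn by (auto simp: M1_def nth_append N_def)
    next
      case False
      then have k: "k < N" using that by simp
      have "ws ! k = M (2 * n + k) # ws ! M (3 * n + k) \<and> M (3 * n + k) < k"
        using nd k that by (auto simp: nodes_def N_def)
      moreover have "M1 (2 * n + k) = M (2 * n + k)" "M1 (3 * n + k) = M (3 * n + k)"
        using k Nn by (auto simp: M1_def)
      ultimately show ?thesis using k by (simp add: nth_append N_def)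
    qed
    have "(ws @ [x]) ! 0 = []" using root inner by (cases "ws = []") (auto simp: nth_append)
    from runs_spell[OF f1 _ Nn(1) this links, of U] that T K x Nn
    have "rn spell (r1, M1) U (\<lambda>(r', M') V. U \<le> V + (10 * n + 3) \<and>
      (\<forall>k. k \<notin> {rAdr, rK, rL, rE} \<longrightarrow> r' k = r1 k) \<and> r' rL = length x \<and>
      map M' [0..<length x] = x \<and> (\<forall>d\<ge>n. M' d = M1 d))"
      by (simp add: N_def r1_def)
    then show ?thesis by (rule runs_mono) (use that in auto)
  qed
  let ?S3 = "\<lambda>(r', M') U. T \<le> U + (6 + (10 * n + 3) + ko) \<and>
    (\<forall>k. k \<le> 21 \<longrightarrow> r' k = r k) \<and>
    (\<forall>t<\<sigma>. M' (6 * n + t) = inv (\<pi> x) t) \<and>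
    (\<forall>d. n \<le> d \<and> d < 6 * n \<or> 6 * n + \<sigma> \<le> d \<longrightarrow> M' d = M1 d)"
  have orders: "rn orders (r2, M2) U ?S3" if S2: "?S2 (r2, M2) U" for r2 M2 U
  proof -
    have f2: "fixed_regs r2" using fixed_regs_frame[OF f1, of r2] S2 by simp
    show ?thesis
    proof (rule runs_mono[OF runs_orders[OF f2, of x M2 U, folded ko_def]], goal_cases)
      case (6 r3 M3 V)
      then show ?case using S2 by (auto simp: r1_def)
    qed (use S2 x T K in auto)
  qed
  let ?S4 = "\<lambda>(r', M') U. T \<le> U + (6 + (10 * n + 3) + ko + kl) \<and>
    (\<forall>k. k \<le> 20 \<longrightarrow> r' k = r k) \<and> r' rAcc = hi x \<and>
    (\<forall>d<\<sigma>. M' (6 * n + \<sigma> + (N * \<sigma> + d)) = lo (x @ [d]) \<and>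
            M' (6 * n + \<sigma> + area + (N * \<sigma> + d)) = hi (x @ [d])) \<and>
    (\<forall>p<n. M' (n + p) = (if lf p \<in> Pre x then lo (x @ [row (lf p) ! length x]) else M (n + p))) \<and>
    (\<forall>d. 2 * n \<le> d \<and> d < 6 * n \<or> 6 * n + \<sigma> \<le> d \<and> d < 6 * n + \<sigma> + N * \<sigma> \<or>
         6 * n + \<sigma> + area \<le> d \<and> d < 6 * n + \<sigma> + area + N * \<sigma> \<longrightarrow> M' d = M1 d)"
  have layout: "rn layout (r3, M3) U ?S4" if S3: "?S3 (r3, M3) U" for r3 M3 U
  proof -
    have fr: "\<And>k. k \<le> 21 \<Longrightarrow> r3 k = r k" using S3 by auto
    have f3: "fixed_regs r3" using fixed_regs_frame[OF c, of r3] fr by simp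
    have M3: "\<And>d. n \<le> d \<Longrightarrow> d < 6 * n \<Longrightarrow> M3 d = M1 d" "\<And>d. 6 * n + \<sigma> \<le> d \<Longrightarrow> M3 d = M1 d"
      using S3 by auto
    have M1: "\<And>p. p < n \<Longrightarrow> M1 (n + p) = M (n + p)" "\<And>d. 6 * n + \<sigma> \<le> d \<Longrightarrow> M1 d = M d"
      using Nn by (auto simp: M1_def)
    show ?thesis
    proof (rule runs_mono[OF runs_layout[OF f3, of N x M3 "\<lambda>d. lo (z d)" "\<lambda>d. hi (z d)" e U, folded kl_def]], goal_cases)
      case (7 d)
      then show ?case by (simp add: z_def lo_Nil hi_Nil e_def)
    next
      case (8 d)
      then have "ws \<noteq> []" by (auto simp: N_def)
      then have v: "r rV < N" "x = r rA # y" using inner by (auto simp: N_def y_def)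
      then have "M (6 * n + \<sigma> + (r rV * \<sigma> + d)) = lo (y @ [d])"
        "M (6 * n + \<sigma> + area + (r rV * \<sigma> + d)) = hi (y @ [d])"
        using nd 8 by (auto simp: nodes_def N_def y_def)
      then show ?case using v 8 fr M3 M1 x by (simp add: z_def e_def)
    next
      case (10 d p)
      then have "Pre (z d) = {lo (z d)..<hi (z d)}" using z[of d] by (intro Pre_interval) auto
      then show ?case using lf_Pre_Cons[OF 10(2) z(1)[OF 10(1)]] ze by auto
    next
      case (11 d)
      then show ?case using rank_cnt z ze by simp
    next
      case (13 r4 M4 V)
      then show ?case using S3 M3 M1 by auto
    qed (use S3 fr Nn x acc T K lo_hi_le z in \<open>auto simp: less_imp_le\<close>)
  qed
  have fin: "rn (put rNhi rN rAcc ;; Op Add rN rN rOne) (r4, M4) U ?Q" if S4: "?S4 (r4, M4) U" for r4 M4 U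
  proof -
    have fr: "\<And>k. k \<le> 20 \<Longrightarrow> r4 k = r k" using S4 by auto
    have f4: "fixed_regs r4" using fixed_regs_frame[OF c, of r4] fr by simp
    have U: "T \<le> U + 115 * area" using S4 K by auto
    have r4: "r4 rAcc = hi x" "r4 rN = N" using S4 Nn by auto
    have M4: "M4 (n + p) = (if lf p \<in> Pre x then lo (x @ [row (lf p) ! length x]) else M (n + p))"
      if "p < n" for p using S4 that by auto
    define M5 where "M5 = M4(5 * n + N := hi x)"
    have "nodes (ws @ [x]) M5"
      unfolding nodes_def
    proof (intro allI impI)
      fix k assume "k < length (ws @ [x])"
      then consider "k = N" | "k < N" unfolding N_def by fastforce
      then show "(0 < k \<longrightarrow> (ws @ [x]) ! k = M5 (2 * n + k) # (ws @ [x]) ! M5 (3 * n + k) \<and> M5 (3 * n + k) < k) \<and>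
        M5 (4 * n + k) = lo ((ws @ [x]) ! k) \<and> M5 (5 * n + k) = hi ((ws @ [x]) ! k) \<and>
        (\<forall>c<\<sigma>. M5 (6 * n + \<sigma> + (k * \<sigma> + c)) = lo ((ws @ [x]) ! k @ [c]) \<and>
            M5 (6 * n + \<sigma> + area + (k * \<sigma> + c)) = hi ((ws @ [x]) ! k @ [c]))"
      proof cases
        case 1
        have "M5 (2 * n + N) = r rA" "M5 (3 * n + N) = r rV" "M5 (4 * n + N) = lo x"
          using S4 Nn by (auto simp: M1_def M5_def)
        moreover have "M5 (5 * n + N) = hi x" by (simp add: M5_def)
        moreover have "M5 (6 * n + \<sigma> + (N * \<sigma> + c)) = lo (x @ [c])"
          "M5 (6 * n + \<sigma> + area + (N * \<sigma> + c)) = hi (x @ [c])" if "c < \<sigma>" for c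
          using S4 Nn that by (auto simp: M5_def)
        moreover have "0 < N \<Longrightarrow> ws \<noteq> []" by (auto simp: N_def)
        ultimately show ?thesis using 1 inner by (auto simp: nth_append N_def)
      next
        case 2
        have "M5 (2 * n + k) = M (2 * n + k)" "M5 (3 * n + k) = M (3 * n + k)"
          "M5 (4 * n + k) = M (4 * n + k)" "M5 (5 * n + k) = M (5 * n + k)"
          using S4 Nn 2 by (auto simp: M1_def M5_def)
        moreover have "M5 (6 * n + \<sigma> + (k * \<sigma> + c)) = M (6 * n + \<sigma> + (k * \<sigma> + c))"
          "M5 (6 * n + \<sigma> + area + (k * \<sigma> + c)) = M (6 * n + \<sigma> + area + (k * \<sigma> + c))" if "c < \<sigma>" for c
          using S4 Nn index_bound[OF 2 that] by (auto simp: M1_def M5_def)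
        ultimately show ?thesis using 2 nd by (auto simp: nth_append nodes_def N_def)
      qed
    qed
    moreover have "M5 (n + p) = M4 (n + p)" if "p < n" for p using that Nn by (simp add: M5_def)
    ultimately show ?thesis
      using U T s Nn(1) r4 fr M4 by (intro vcg) (simp_all add: fixed_regsD[OF f4] N_def M5_def)
  qed
  show ?thesis
    unfolding new_node_def
  proof (rule runs_SeqI[OF start])
    fix r' M' U assume "?S1 (r', M') U"
    then have "r' = r1" "M' = M1" "T \<le> U + 6" by auto
    then show "rn (spell ;; orders ;; layout ;; put rNhi rN rAcc ;; Op Add rN rN rOne) (r', M') U ?Q"
      using runs_SeqI[OF spell runs_SeqI[OF orders runs_SeqI[OF layout fin]], of U] by simp
  qed
qed

section \<open>The search and its amortised running time\<close>

definition search_state ::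
  "nat list list \<Rightarrow> nat \<Rightarrow> nat set \<Rightarrow> (nat \<Rightarrow> nat) \<Rightarrow> (nat \<Rightarrow> nat) \<Rightarrow> bool" where
  "search_state ws v A r M \<longleftrightarrow> fixed_regs r \<and> r rN = length ws \<and> r rV = v \<and> nodes ws M \<and>
     queue ws v A \<and> (\<forall>p<n. M (n + p) = block_start (set ws) (lf p))"

definition node_cost :: nat where "node_cost = 120 * area"

lemma search_state_regs:
  assumes "search_state ws v A r M" "\<And>k. k < 13 \<Longrightarrow> r' k = r k" "r' rN = r rN"
  shows "search_state ws v A r' M"
  using assms fixed_regs_frame[of r r'] by (simp add: search_state_def)

text \<open>Amortised cost: every time bound below counts \<open>node_cost\<close> for each new word of the queue, whose
  length never exceeds \<open>n\<close>.\<close>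

lemma runs_visit:
  assumes st: "search_state ws v (firsts y D) r M" and v: "v < length ws" and y: "y = ws ! v"
    and p: "p \<in> Pre (y @ [c])" "D \<subseteq> Pre y" "p \<notin> D"
    and regs: "r rP = p" "r rYlo = lo y" "r rYhi = hi y" "r rHi = hi (y @ [c])"
    and T: "node_cost * n + 20 \<le> T + node_cost * length ws"
  shows "rn visit (r, M) T (\<lambda>(r', M') U. \<exists>zs. search_state (ws @ zs) v (firsts y (insert p D)) r' M' \<and>
    (\<forall>k<18. r' k = r k) \<and> T + node_cost * length ws \<le> U + 20 + node_cost * length (ws @ zs))"
    (is "rn _ _ _ ?Q")
proof -
  define a where "a = b ! p"
  have f: "fixed_regs r" and N: "r rN = length ws" and rv: "r rV = v" and nd: "nodes ws M"
    and Q: "queue ws v (firsts y D)" and bs: "\<And>p. p < n \<Longrightarrow> M (n + p) = block_start (set ws) (lf p)"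
    using st by (auto simp: search_state_def)
  note s = sizes and [simp] = fixed_regsD[OF f]
  have ly: "length y < n" and sy: "set y \<subseteq> {..<\<sigma>}"
    using queue_nth_less[OF Q v] queue_symbols[OF Q v] by (auto simp: y)
  have py: "p \<in> Pre y" "p < n" using p Pre_less[OF p(1)] by (auto simp: Pre_snoc)
  have hn: "lo y \<le> n" "hi y \<le> n" "hi (y @ [c]) \<le> n"
    using lo_hi_le[of y] lo_hi_le[of "y @ [c]"] ly sy Pre_symbols[OF p(1)] by auto
  have Tn: "20 \<le> T"
    using T queue_length[OF Q] mult_le_mono2[of "length ws" n node_cost] by linarith
  define first where "first \<longleftrightarrow> (\<forall>p'\<in>Pre y. p' < p \<longrightarrow> b ! p' \<noteq> a)"
  define more where "more \<longleftrightarrow> rank b a (hi (y @ [c])) < rank b a (hi y)"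
  have first: "rank b a p = rank b a (lo y) \<longleftrightarrow> first"
    using rank_eq_first[of y p a] ly py by (simp add: first_def)
  have more: "first \<Longrightarrow> more \<longleftrightarrow> branching (a # y)"
    using rank_less_branching[OF ly p(1)] by (simp add: first_def more_def a_def)
  have ins: "firsts y (insert p D) = (if first then insert a (firsts y D) else firsts y D)"
    unfolding firsts_insert first_def a_def by (rule refl)
  let ?S = "\<lambda>(r', M') U. M' = M \<and> T \<le> U + 10 \<and> (\<forall>k. k < 18 \<or> k = rN \<longrightarrow> r' k = r k) \<and> r' rA = a \<and>
    r' rX = of_bool first * of_bool more"
  have test: "rn visit_test (r, M) T ?S"
    unfolding visit_test_def using Tn s py hn regs first
    by (intro vcg) (simp_all add: a_def[symmetric] more_def[symmetric])
  show ?thesis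
    unfolding visit_def
  proof (rule runs_SeqI[OF test], rule runs_If)
    fix r1 M1 U assume S: "?S (r1, M1) U"
    then show "1 \<le> U" using Tn by auto
    have U: "T \<le> U + 10" and [simp]: "M1 = M" and fr: "\<And>k. k < 18 \<or> k = rN \<Longrightarrow> r1 k = r k"
      using S by auto
    show "rn (get rAcc rLen rP ;; new_node) (r1, M1) (U - 1) ?Q" if "r1 rX \<noteq> 0"
    proof -
      have fst: first and B: "branching (a # y)" using that S more by (auto split: if_splits)
      \<comment> \<open>The first occurrence of \<open>a\<close> is a single row and has not been
        visited before, so \<open>a # y\<close> cannot be in the queue already.\<close>
      have a: "a \<notin> firsts y D" using not_in_firsts[OF p(2) py(1) p(3)] fst by (simp add: first_def a_def)
      have Q': "queue (ws @ [a # y]) v (insert a (firsts y D))" using queue_add[OF Q v] B a by (simp add: y)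
      then have wn: "length ws < n" using queue_length by fastforce
      have lfp: "lf p \<in> Pre (a # y)" using lf_Pre_Cons[OF py(2) ly] py by (simp add: a_def)
      have acc: "M (n + p) = lo (a # y)"
        using bs[OF py(2)] queue_block_start(1)[OF Q v, of a "lf p"] B a lfp lf_less[OF py(2)] by (simp add: y)
      \<comment> \<open>The extended queue still has at most \<open>n\<close> words, so the reserve
        of \<open>node_cost\<close> for each missing word covers this insertion.\<close>
      have "node_cost * Suc (length ws) \<le> node_cost * n" using wn by (intro mult_left_mono) auto
      then have TU: "node_cost + 20 \<le> T" using T by simp
      define r2 where "r2 = r1(rAdr := n + p, rAcc := lo (a # y))"
      have fr2: "\<And>k. k < 18 \<or> k = rN \<Longrightarrow> r2 k = r k" "r2 rA = a" "r2 rAcc = lo (a # y)"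
        using fr S by (auto simp: r2_def)
      have f2: "fixed_regs r2" using fixed_regs_frame[OF f, of r2] fr2 by simp
      let ?S2 = "\<lambda>(r', M') V. r' = r2 \<and> M' = M \<and> V = U - 3"
      have get: "rn (get rAcc rLen rP) (r1, M1) (U - 1) ?S2"
        using TU U s fr regs py acc by (intro vcg) (simp_all add: r2_def)
      show ?thesis
      proof (rule runs_SeqI[OF get])
        fix r' M' V assume "?S2 (r', M') V"
        then have [simp]: "r' = r2" "M' = M" "V = U - 3" by auto
        have "rn new_node (r2, M) (U - 3) ?Q"
        proof (rule runs_mono[OF runs_new_node[OF f2 nd, where x = "a # y"]], goal_cases)
          case (4)
          then show ?case using queue_root[OF Q] fr2 rv v B by (simp add: y)
        next
          case (7 r3 M3 W)
          then have R: "U - 3 \<le> W + node_cost" "\<And>k. k < 20 \<Longrightarrow> r3 k = r2 k" "r3 rN = Suc (length ws)"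
            "nodes (ws @ [a # y]) M3"
            "\<And>p. p < n \<Longrightarrow> M3 (n + p) = (if lf p \<in> Pre (a # y)
               then lo ((a # y) @ [row (lf p) ! length (a # y)]) else M (n + p))"
            by (auto simp: node_cost_def)
          have "M3 (n + p') = block_start (set (ws @ [a # y])) (lf p')" if "p' < n" for p'
            using queue_block_start(2)[OF Q v _ a lf_less[OF that]] B R(5)[OF that] bs[OF that] by (simp add: y)
          moreover have "fixed_regs r3" using fixed_regs_frame[OF f2, of r3] R(2) by simp
          ultimately have "search_state (ws @ [a # y]) v (firsts y (insert p D)) r3 M3"
            using R Q' fst fr2 rv by (simp add: search_state_def ins)
          moreover have "T + node_cost * length ws \<le> W + 20 + node_cost * length (ws @ [a # y])"
            using R(1) U TU by simp
          moreover have "\<forall>k<18. r3 k = r k" using R(2) fr2(1) by simp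
          ultimately show ?case by blast
        qed (use fr2 N wn TU U v in \<open>auto simp: node_cost_def\<close>)
        then show "rn new_node (r', M') V ?Q" by simp
      qed
    qed
    show "rn (Const rX 0) (r1, M1) (U - 1) ?Q" if "r1 rX = 0"
    proof -
      have "\<not> (first \<and> branching (a # y))" using that S more by auto
      moreover have "queue ws v (insert a (firsts y D))" if "\<not> branching (a # y)"
        using queue_skip[OF Q v, of a] that y by simp
      ultimately have "queue ws v (firsts y (insert p D))" using Q by (cases first) (auto simp: ins)
      then have "search_state (ws @ []) v (firsts y (insert p D)) r M" using st by (simp add: search_state_def)
      then have "search_state (ws @ []) v (firsts y (insert p D)) (r1(rX := 0)) M"
        by (rule search_state_regs) (use fr in auto)
      moreover have "T + node_cost * length ws \<le> U - 2 + 20 + node_cost * length (ws @ [])"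
        using U Tn by simp
      ultimately show ?thesis using U Tn fr by (intro vcg) (auto intro!: exI[of _ "[]"])
    qed
  qed
qed

text \<open>The children are visited in the numerical order of \<open>c\<close>, not in the order
  \<open>\<pi> y\<close>, so the visited rows \<open>D\<close> need not be an initial part of the
  interval of \<open>y\<close>.\<close>

lemma runs_visit_child:
  assumes st: "search_state ws v (firsts y D) r M" and v: "v < length ws" and y: "y = ws ! v"
    and c: "r rC = c" "c < \<sigma>" and D: "D = (\<Union>d<c. Pre (y @ [d]))"
    and regs: "r rYlo = lo y" "r rYhi = hi y"
    and T: "node_cost * n + (30 * n + 40) \<le> T + node_cost * length ws"
  shows "rn visit_child (r, M) T (\<lambda>(r', M') U. \<exists>zs.
    search_state (ws @ zs) v (firsts y (\<Union>d<Suc c. Pre (y @ [d]))) r' M' \<and>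
    (\<forall>k<16. r' k = r k) \<and> T + node_cost * length ws \<le> U + (30 * n + 40) + node_cost * length (ws @ zs))"
    (is "rn _ _ _ ?Q")
proof -
  define z where "z = y @ [c]"
  have f: "fixed_regs r" and N: "r rN = length ws" and rv: "r rV = v" and nd: "nodes ws M"
    and Q: "queue ws v (firsts y D)"
    using st by (auto simp: search_state_def)
  note s = sizes and [simp] = fixed_regsD[OF f]
  have ly: "length y < n" and sy: "set y \<subseteq> {..<\<sigma>}"
    using queue_nth_less[OF Q v] queue_symbols[OF Q v] by (auto simp: y)
  have wn: "length ws \<le> n" using queue_length[OF Q] .
  have Tn: "30 * n + 40 \<le> T"
    using T wn mult_le_mono2[of "length ws" n node_cost] by linarith
  have I: "Pre z = {lo z..<hi z}" "lo z \<le> hi z" "hi z \<le> n"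
    using Pre_interval[of z] lo_hi_le[of z] ly sy c by (auto simp: z_def)
  have Dy: "D \<subseteq> Pre y" "Pre z \<subseteq> Pre y" "D \<inter> Pre z = {}"
    using ly by (auto simp: D z_def Pre_snoc)
  have DS: "D \<union> Pre z = (\<Union>d<Suc c. Pre (y @ [d]))" by (auto simp: D z_def less_Suc_eq)
  \<comment> \<open>\<open>zs\<close> collects the words appended so far; their cost appears as the
    growth of the queue, while every row visited is charged 30. The 9 is the set-up before the
    loop.\<close>
  let ?Inv = "\<lambda>(r', M') U. \<exists>zs. search_state (ws @ zs) v (firsts y (D \<union> {lo z..<r' rP})) r' M' \<and>
    (\<forall>k<16. r' k = r k) \<and> r' rHi = hi z \<and> lo z \<le> r' rP \<and> r' rP \<le> hi z \<and>
    r' rCond = of_bool (r' rP < hi z) \<and>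
    T + node_cost * length ws + 30 * lo z \<le> U + 9 + 30 * r' rP + node_cost * length (ws @ zs)"
  have loop: "rn (WhileNZ rCond visit_step) (r', M') U ?Q" if "?Inv (r', M') U" for r' M' U
    using that
  proof (rule runs_WhileI[where Inv = ?Inv], goal_cases)
    case (1 r' M' U)
    then obtain zs where A: "search_state (ws @ zs) v (firsts y (D \<union> {lo z..<r' rP})) r' M'" "r' rP \<le> hi z"
      "T + node_cost * length ws + 30 * lo z \<le> U + 9 + 30 * r' rP + node_cost * length (ws @ zs)" by auto
    have "length (ws @ zs) \<le> n" using A(1) queue_length unfolding search_state_def by blast
    then have "node_cost * length (ws @ zs) \<le> node_cost * n" by (intro mult_le_mono2)
    then show ?case using A(2,3) T I(3) by linarith
  next
    case (2 r' M' U)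
    then obtain zs where A: "search_state (ws @ zs) v (firsts y (D \<union> {lo z..<r' rP})) r' M'" "r' rP < hi z"
      "lo z \<le> r' rP" "r' rHi = hi z"
      "T + node_cost * length ws + 30 * lo z \<le> U + 9 + 30 * r' rP + node_cost * length (ws @ zs)"
      and fr: "\<And>k. k < 16 \<Longrightarrow> r' k = r k" by (auto split: if_splits)
    define p where "p = r' rP"
    have "length (ws @ zs) \<le> n" using A(1) queue_length unfolding search_state_def by blast
    then have G: "node_cost * length (ws @ zs) \<le> node_cost * n" by (intro mult_le_mono2)
    have T': "node_cost * n + 20 \<le> U - 1 + node_cost * length (ws @ zs)" "30 \<le> U"
      using A(2,3,5) T I(3) G by linarith+
    have p: "p \<in> Pre (y @ [c])" using A(2,3) I(1) by (simp add: z_def p_def)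
    have D': "D \<union> {lo z..<p} \<subseteq> Pre y" "p \<notin> D \<union> {lo z..<p}"
      using Dy I(1) p A(2) by (auto simp: p_def z_def)
    have ins: "insert p (D \<union> {lo z..<p}) = D \<union> {lo z..<Suc p}" using A(3) by (auto simp: p_def)
    have visit: "rn visit (r', M') (U - 1) (\<lambda>(r'', M'') V. \<exists>zs'. search_state ((ws @ zs) @ zs') v
        (firsts y (insert p (D \<union> {lo z..<p}))) r'' M'' \<and> (\<forall>k<18. r'' k = r' k) \<and>
        U - 1 + node_cost * length (ws @ zs) \<le> V + 20 + node_cost * length ((ws @ zs) @ zs'))" (is "rn _ _ _ ?S")
      by (rule runs_visit[where c = c])
        (use A v y p D' fr regs T' in \<open>auto simp: nth_append p_def[symmetric] z_def\<close>)
    show ?case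
      unfolding visit_step_def
    proof (rule runs_SeqI[OF visit])
      fix r'' M'' V assume "?S (r'', M'') V"
      then obtain zs' where B: "search_state (ws @ (zs @ zs')) v (firsts y (D \<union> {lo z..<Suc p})) r'' M''"
        "\<And>k. k < 18 \<Longrightarrow> r'' k = r' k"
        "U - 1 + node_cost * length (ws @ zs) \<le> V + 20 + node_cost * length (ws @ (zs @ zs'))"
        using ins by auto
      have f'': "fixed_regs r''" using B(1) by (simp add: search_state_def)
      have r'': "r'' rP = p" "r'' rHi = hi z" using B(2) A(4) by (auto simp: p_def)
      have "length (ws @ (zs @ zs')) \<le> n" using B(1) queue_length unfolding search_state_def by blast
      then have "node_cost * length (ws @ (zs @ zs')) \<le> node_cost * n" by (intro mult_le_mono2)
      then have V: "2 \<le> V" using B(3) A(2,3,5) T I(3) unfolding p_def by linarith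
      have st': "search_state (ws @ (zs @ zs')) v (firsts y (D \<union> {lo z..<Suc p}))
          (r''(rP := Suc p, rCond := x)) M''" for x
        by (rule search_state_regs[OF B(1)]) auto
      have TT: "T + node_cost * length ws + 30 * lo z \<le> V - 2 + 9 + 30 * Suc p + node_cost * length (ws @ (zs @ zs'))"
      proof -
        have "t \<le> V - 2 + 9 + 30 * Suc q + g'"
          if "t \<le> U + 9 + 30 * q + g" "U - 1 + g \<le> V + 20 + g'" for t q g g'
          using that V T'(2) by simp
        from this[OF A(5) B(3)] show ?thesis unfolding p_def .
      qed
      have pz: "p < hi z" "lo z \<le> p" using A(2,3) by (auto simp: p_def)
      have inv: "?Inv (r''(rP := Suc p, rCond := of_bool (Suc p < hi z)), M'') (V - 2)"
        using st' TT fr B(2) pz r'' unfolding prod.case by (intro exI[of _ "zs @ zs'"]) simp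
      show "rn (Op Add rP rP rOne ;; Op Less rCond rP rHi) (r'', M'') V ?Inv"
        using V r'' pz I(3) s inv by (intro vcg) (simp_all add: fixed_regsD[OF f''] numeral_2_eq_2)
    qed
  next
    case (3 r' M' U)
    then obtain zs where A: "search_state (ws @ zs) v (firsts y (D \<union> {lo z..<r' rP})) r' M'" "r' rP = hi z"
      "T + node_cost * length ws + 30 * lo z \<le> U + 9 + 30 * r' rP + node_cost * length (ws @ zs)"
      "\<forall>k<16. r' k = r k" by (auto split: if_splits)
    have "search_state (ws @ zs) v (firsts y (\<Union>d<Suc c. Pre (y @ [d]))) r' M'"
      using A(1,2) I(1) DS by simp
    moreover have "T + node_cost * length ws \<le> U - 1 + (30 * n + 40) + node_cost * length (ws @ zs)"
      using A(2,3) I(3) by linarith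
    ultimately show ?case using A(4) by blast
  qed
  have M: "M (6 * n + \<sigma> + (v * \<sigma> + c)) = lo z" "M (6 * n + \<sigma> + area + (v * \<sigma> + c)) = hi z"
    using nd v c(2) by (auto simp: nodes_def z_def y)
  have idx: "v * \<sigma> + c < area" using index_area[of v c] v wn c by simp
  have idx0: "v * \<sigma> < area" using idx by linarith
  have st': "search_state ws v (firsts y D) (r(rAdr := a, rP := lo z, rHi := hi z, rCond := x)) M" for a x
    by (rule search_state_regs[OF st]) auto
  have inv: "?Inv (r(rAdr := a, rP := lo z, rHi := hi z, rCond := of_bool (lo z < hi z)), M) (T - 9)" for a
    using st' I Tn unfolding prod.case by (intro exI[of _ "[]"]) simp
  show ?thesis
    unfolding visit_child_def
  proof (intro vcg, goal_cases)
    case 10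
    have "T - 4 - 4 - 1 = T - 9" by simp
    then show ?case using loop[OF inv[of "6 * n + \<sigma> + area + (v * \<sigma> + c)"]] rv c M by (simp add: fun_upd_twist)
  qed (use Tn s idx idx0 c rv M in simp_all)
qed

text \<open>Every child is charged for \<open>n\<close> rows although the child intervals are
  disjoint; laying out a word takes time of order \<open>\<sigma> * n\<close> anyway.\<close>

definition visit_cost :: nat where "visit_cost = \<sigma> * (30 * n + 50) + 10"

lemma search_state_length: "search_state ws v A r M \<Longrightarrow> node_cost * length ws \<le> node_cost * n"
  using queue_length unfolding search_state_def by (intro mult_le_mono2) blast

lemma runs_visit_node:
  assumes st: "search_state ws v {} r M" and v: "v < length ws"
    and T: "node_cost * n + visit_cost \<le> T + node_cost * length ws"
  shows "rn visit_node (r, M) T (\<lambda>(r', M') U. \<exists>zs.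
    search_state (ws @ zs) v ((!) b ` Pre (ws ! v)) r' M' \<and>
    (\<forall>k<13. r' k = r k) \<and> T + node_cost * length ws \<le> U + visit_cost + node_cost * length (ws @ zs))"
    (is "rn _ _ _ ?Q")
proof -
  define y where "y = ws ! v"
  define kc where "kc = 30 * n + 50"
  have f: "fixed_regs r" and rv: "r rV = v" and nd: "nodes ws M" and Q: "queue ws v {}"
    using st by (auto simp: search_state_def)
  note s = sizes and [simp] = fixed_regsD[OF f]
  have ly: "length y < n" using queue_nth_less[OF Q v] by (simp add: y_def)
  have wn: "length ws \<le> n" using queue_length[OF Q] .
  have vc: "visit_cost = \<sigma> * kc + 10" by (simp add: visit_cost_def kc_def)
  have Tn: "\<sigma> * kc + 10 \<le> T"
    using T search_state_length[OF st] vc by linarith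
  have Py: "(\<Union>d<\<sigma>. Pre (y @ [d])) = Pre y"
    using ly Pre_nth_less[of _ y] by (auto simp: Pre_snoc)
  let ?Inv = "\<lambda>(r', M') U. \<exists>zs. search_state (ws @ zs) v (firsts y (\<Union>d<r' rC. Pre (y @ [d]))) r' M' \<and>
    (\<forall>k<13. r' k = r k) \<and> r' rYlo = lo y \<and> r' rYhi = hi y \<and> r' rC \<le> \<sigma> \<and>
    r' rCond = of_bool (r' rC < \<sigma>) \<and>
    T + node_cost * length ws \<le> U + 6 + r' rC * kc + node_cost * length (ws @ zs)"
  have loop: "rn (WhileNZ rCond visit_child_step) (r', M') U ?Q" if "?Inv (r', M') U" for r' M' U
    using that
  proof (rule runs_WhileI[where Inv = ?Inv], goal_cases)
    case (1 r' M' U)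
    then obtain zs A where A: "search_state (ws @ zs) v A r' M'" "r' rC \<le> \<sigma>"
      "T + node_cost * length ws \<le> U + 6 + r' rC * kc + node_cost * length (ws @ zs)" by auto
    have "r' rC * kc \<le> \<sigma> * kc" using A(2) by (intro mult_le_mono1)
    then show ?case using A(3) T vc search_state_length[OF A(1)] by linarith
  next
    case (2 r' M' U)
    then obtain zs where A: "search_state (ws @ zs) v (firsts y (\<Union>d<r' rC. Pre (y @ [d]))) r' M'"
      "r' rC < \<sigma>" "r' rYlo = lo y" "r' rYhi = hi y"
      "T + node_cost * length ws \<le> U + 6 + r' rC * kc + node_cost * length (ws @ zs)"
      and fr: "\<And>k. k < 13 \<Longrightarrow> r' k = r k" by (auto split: if_splits)
    define c where "c = r' rC"
    have "Suc c * kc \<le> \<sigma> * kc" using A(2) by (intro mult_le_mono1) (simp add: c_def)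
    then have ck: "c * kc + kc \<le> \<sigma> * kc" by simp
    have T': "node_cost * n + (30 * n + 40) \<le> U - 1 + node_cost * length (ws @ zs)" "30 * n + 44 \<le> U"
      using A(5) T vc search_state_length[OF A(1)] ck kc_def unfolding c_def[symmetric] by linarith+
    have visit: "rn visit_child (r', M') (U - 1) (\<lambda>(r'', M'') V. \<exists>zs'. search_state ((ws @ zs) @ zs') v
        (firsts y (\<Union>d<Suc c. Pre (y @ [d]))) r'' M'' \<and> (\<forall>k<16. r'' k = r' k) \<and>
        U - 1 + node_cost * length (ws @ zs) \<le> V + (30 * n + 40) + node_cost * length ((ws @ zs) @ zs'))" (is "rn _ _ _ ?S")
      by (rule runs_visit_child[where D = "\<Union>d<c. Pre (y @ [d])"])
        (use A v T' in \<open>auto simp: nth_append c_def[symmetric] y_def\<close>)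
    show ?case
      unfolding visit_child_step_def
    proof (rule runs_SeqI[OF visit])
      fix r'' M'' V assume "?S (r'', M'') V"
      then obtain zs' where B: "search_state (ws @ (zs @ zs')) v (firsts y (\<Union>d<Suc c. Pre (y @ [d]))) r'' M''"
        "\<And>k. k < 16 \<Longrightarrow> r'' k = r' k"
        "U - 1 + node_cost * length (ws @ zs) \<le> V + (30 * n + 40) + node_cost * length (ws @ (zs @ zs'))"
        by auto
      have f'': "fixed_regs r''" using B(1) by (simp add: search_state_def)
      have r'': "r'' rC = c" using B(2) by (auto simp: c_def)
      have V: "2 \<le> V"
        using B(3) A(5) T vc search_state_length[OF B(1)] ck kc_def unfolding c_def[symmetric] by linarith
      have st': "search_state (ws @ (zs @ zs')) v (firsts y (\<Union>d<Suc c. Pre (y @ [d])))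
          (r''(rC := Suc c, rCond := x)) M''" for x
        by (rule search_state_regs[OF B(1)]) auto
      have TT: "T + node_cost * length ws \<le> V - 2 + 6 + Suc c * kc + node_cost * length (ws @ (zs @ zs'))"
      proof -
        have "t \<le> V - 2 + 6 + (kc + q) + g'"
          if "t \<le> U + 6 + q + g" "U - 1 + g \<le> V + (30 * n + 40) + g'" for t q g g'
          using that V T'(2) by (simp add: kc_def)
        from this[OF A(5) B(3)] show ?thesis by (simp only: c_def mult_Suc)
      qed
      have inv: "?Inv (r''(rC := Suc c, rCond := of_bool (Suc c < \<sigma>)), M'') (V - 2)"
        using st' TT fr B(2) A(2,3,4) unfolding prod.case by (intro exI[of _ "zs @ zs'"]) (simp add: c_def)
      show "rn (Op Add rC rC rOne ;; Op Less rCond rC rSig) (r'', M'') V ?Inv"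
        using V r'' A(2) s inv c_def by (intro vcg) (simp_all add: fixed_regsD[OF f''] numeral_2_eq_2)
    qed
  next
    case (3 r' M' U)
    then obtain zs where A: "search_state (ws @ zs) v (firsts y (\<Union>d<r' rC. Pre (y @ [d]))) r' M'"
      "r' rC = \<sigma>" "T + node_cost * length ws \<le> U + 6 + r' rC * kc + node_cost * length (ws @ zs)"
      "\<forall>k<13. r' k = r k" by (auto split: if_splits)
    have "search_state (ws @ zs) v ((!) b ` Pre (ws ! v)) r' M'"
      using A(1,2) Py firsts_Pre by (simp add: y_def)
    moreover have "T + node_cost * length ws \<le> U - 1 + visit_cost + node_cost * length (ws @ zs)"
      using A(2,3) vc by simp
    ultimately show ?case using A(4) by blast
  qed
  have M: "M (4 * n + v) = lo y" "M (5 * n + v) = hi y"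
    using nd v by (auto simp: nodes_def y_def)
  have st': "search_state ws v {} (r(rAdr := a, rYlo := lo y, rYhi := hi y, rC := 0, rCond := x)) M" for a x
    by (rule search_state_regs[OF st]) auto
  have inv: "?Inv (r(rAdr := a, rYlo := lo y, rYhi := hi y, rC := 0, rCond := 1), M) (T - 2 - 2 - 1 - 1)" for a
    using st' Tn s unfolding prod.case by (intro exI[of _ "[]"]) (simp add: firsts_def)
  show ?thesis
    unfolding visit_node_def
  proof (intro vcg, goal_cases)
    case 8
    then show ?case using loop[OF inv[of "5 * n + v"]] rv M s by (simp add: fun_upd_twist)
  qed (use Tn s v wn rv M in simp_all)
qed

text \<open>\<open>node_cost\<close> on the side of \<open>T\<close> reflects that the root is in
  the queue and has been paid for.\<close>

lemma runs_search:
  assumes st: "search_state [[]] 0 {} r M" and T: "node_cost * n + n * (visit_cost + 5) + 10 \<le> T + node_cost"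
  shows "rn search (r, M) T (\<lambda>(r', M') U. fixed_regs r' \<and> r' rRow = r rRow \<and> (\<forall>p<n. M' (n + p) = lf p) \<and>
    T + node_cost \<le> U + (node_cost * n + n * (visit_cost + 5) + 10))"
    (is "rn _ _ _ ?Q")
proof -
  define kv where "kv = visit_cost + 5"
  have f: "fixed_regs r" and N: "r rN = 1" and rv: "r rV = 0"
    using st by (auto simp: search_state_def)
  note s = sizes and [simp] = fixed_regsD[OF f]
  note T = T[folded kv_def]
  let ?Inv = "\<lambda>(r', M') U. \<exists>ws. search_state ws (r' rV) {} r' M' \<and> r' rRow = r rRow \<and>
    r' rV \<le> length ws \<and> r' rCond = of_bool (r' rV < length ws) \<and>
    T + node_cost \<le> U + 3 + r' rV * kv + node_cost * length ws"
  have loop: "rn (WhileNZ rCond search_step) (r', M') U ?Q" if "?Inv (r', M') U" for r' M' U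
    using that
  proof (rule runs_WhileI[where Inv = ?Inv], goal_cases)
    case (1 r' M' U)
    then obtain ws where A: "search_state ws (r' rV) {} r' M'" "r' rV \<le> length ws"
      "T + node_cost \<le> U + 3 + r' rV * kv + node_cost * length ws" by auto
    have "length ws \<le> n" using A(1) queue_length unfolding search_state_def by blast
    then have "r' rV * kv \<le> n * kv" using A(2) by (intro mult_le_mono1) simp
    then show ?case using A(3) T search_state_length[OF A(1)] by linarith
  next
    case (2 r' M' U)
    then obtain ws where A: "search_state ws (r' rV) {} r' M'" "r' rV < length ws"
      "T + node_cost \<le> U + 3 + r' rV * kv + node_cost * length ws" "r' rRow = r rRow"
      by (auto split: if_splits)
    define v where "v = r' rV"
    have wn: "length ws \<le> n" using A(1) queue_length unfolding search_state_def by blast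
    have "Suc v * kv \<le> n * kv" using A(2) wn by (intro mult_le_mono1) (simp add: v_def)
    then have vk: "v * kv + kv \<le> n * kv" by simp
    have T': "node_cost * n + visit_cost \<le> U - 1 + node_cost * length ws" "visit_cost + 5 \<le> U"
      using A(3) T search_state_length[OF A(1)] vk kv_def unfolding v_def[symmetric] by linarith+
    have visit: "rn visit_node (r', M') (U - 1) (\<lambda>(r'', M'') V. \<exists>zs.
        search_state (ws @ zs) v ((!) b ` Pre (ws ! v)) r'' M'' \<and> (\<forall>k<13. r'' k = r' k) \<and>
        U - 1 + node_cost * length ws \<le> V + visit_cost + node_cost * length (ws @ zs))" (is "rn _ _ _ ?S")
      by (rule runs_visit_node) (use A T' in \<open>auto simp: v_def\<close>)
    show ?case
      unfolding search_step_def
    proof (rule runs_SeqI[OF visit])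
      fix r'' M'' V assume "?S (r'', M'') V"
      then obtain zs where B: "search_state (ws @ zs) v ((!) b ` Pre (ws ! v)) r'' M''"
        "\<And>k. k < 13 \<Longrightarrow> r'' k = r' k"
        "U - 1 + node_cost * length ws \<le> V + visit_cost + node_cost * length (ws @ zs)" by auto
      define us where "us = ws @ zs"
      note B = B[folded us_def]
      have vu: "v < length us" "us ! v = ws ! v" using A(2) by (auto simp: us_def v_def nth_append)
      have un: "length us \<le> n" using B(1) queue_length unfolding search_state_def by blast
      have f'': "fixed_regs r''" and N'': "r'' rN = length us" and v'': "r'' rV = v"
        using B(1) by (auto simp: search_state_def)
      have V: "2 \<le> V"
        using B(3) A(3) T search_state_length[OF B(1)] vk kv_def unfolding v_def[symmetric] by linarith
      have "queue us (Suc v) {}"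
        using queue_next[of us v] B(1) vu by (auto simp: search_state_def)
      then have st': "search_state us (Suc v) {} (r''(rV := Suc v, rCond := x)) M''" for x
        using B(1) fixed_regs_frame[OF f'', of "r''(rV := Suc v, rCond := x)"] by (simp add: search_state_def)
      have TT: "T + node_cost \<le> V - 2 + 3 + Suc v * kv + node_cost * length us"
      proof -
        have "t \<le> V - 2 + 3 + (kv + q) + g'"
          if "t \<le> U + 3 + q + g" "U - 1 + g \<le> V + visit_cost + g'" for t q g g'
          using that V T'(2) by (simp add: kv_def)
        from this[OF A(3) B(3)] show ?thesis by (simp only: v_def mult_Suc)
      qed
      have inv: "?Inv (r''(rV := Suc v, rCond := of_bool (Suc v < length us)), M'') (V - 2)"
        using st' TT B(2) A(4) vu unfolding prod.case by (intro exI[of _ us]) simp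
      show "rn (Op Add rV rV rOne ;; Op Less rCond rV rN) (r'', M'') V ?Inv"
        using V v'' N'' vu un s inv by (intro vcg) (simp_all add: fixed_regsD[OF f''] numeral_2_eq_2)
    qed
  next
    case (3 r' M' U)
    then obtain ws where A: "search_state ws (length ws) {} r' M'" "r' rV = length ws" "r' rRow = r rRow"
      "T + node_cost \<le> U + 3 + r' rV * kv + node_cost * length ws" by (auto split: if_splits)
    have f': "fixed_regs r'" and Q: "queue ws (length ws) {}"
      and bs: "\<And>p. p < n \<Longrightarrow> M' (n + p) = block_start (set ws) (lf p)"
      using A(1) by (auto simp: search_state_def)
    \<comment> \<open>With every branching word in the queue all blocks are single rows, so the
      start of the block of \<open>lf p\<close> is \<open>lf p\<close> itself.\<close>
    have "M' (n + p) = lf p" if "p < n" for p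
      using bs[OF that] block_start_complete[OF queue_complete[OF Q] lf_less[OF that]] by simp
    moreover have "length ws * kv \<le> n * kv" using queue_length[OF Q] by (intro mult_le_mono1)
    then have "T + node_cost \<le> U - 1 + (node_cost * n + n * kv + 10)"
      using A(4) search_state_length[OF A(1)] unfolding A(2) by linarith
    ultimately show ?case using A(3) f' by (simp add: kv_def)
  qed
  have st': "search_state [[]] 0 {} (r(rCond := x)) M" for x
    by (rule search_state_regs[OF st]) auto
  have inv: "?Inv (r(rCond := 1), M) (T - 1)"
    using st' T s rv unfolding prod.case by (intro exI[of _ "[[]]"]) simp
  have T1: "1 \<le> T"
    using T mult_le_mono2[of 1 n node_cost] s by linarith
  show ?thesis
    unfolding search_def using loop[OF inv] rv N T1 by (intro vcg) simp_all
qed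

section \<open>Reading off the string and the total cost\<close>

lemma runs_read_off:
  assumes f: "fixed_regs r" and i: "r rRow < n" "row (r rRow) = s" and lfs: "\<And>p. p < n \<Longrightarrow> M (n + p) = lf p"
    and T: "10 * n + 3 \<le> T"
  shows "rn read_off (r, M) T (\<lambda>(r', M') U. map M' [0..<n] = s)"
    (is "rn _ _ _ ?Q")
proof -
  note s = sizes and [simp] = fixed_regsD[OF f]
  \<comment> \<open>The loop starts with \<open>rK = n\<close>, since row \<open>i\<close> is
    \<open>s = rotate n s\<close>. The BWT symbol of the row \<open>rotate (Suc k) s\<close> is
    \<open>s ! k\<close>, and its predecessor is \<open>rotate k s\<close>, so the output is filled
    from the right.\<close>
  let ?Inv = "\<lambda>(r', M') U. fixed_regs r' \<and> r' rK \<le> n \<and> r' rP < n \<and> row (r' rP) = rotate (r' rK) s \<and>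
    (\<forall>k<n. r' rK \<le> k \<longrightarrow> M' k = s ! k) \<and> (\<forall>p<n. M' (n + p) = lf p) \<and> T + 10 * r' rK \<le> U + 2 + 10 * n"
  have loop: "rn (WhileNZ rK read_off_step) (r', M') U ?Q" if "?Inv (r', M') U" for r' M' U
    using that
  proof (rule runs_WhileI[where Inv = ?Inv], goal_cases)
    case (1 r' M' U)
    then show ?case using T by auto
  next
    case (2 r' M' U)
    then obtain k where k: "r' rK = Suc k" by (cases "r' rK") auto
    define p where "p = r' rP"
    have A: "k < n" "p < n" "row p = rotate (Suc k) s" "\<And>j. j < n \<Longrightarrow> k < j \<Longrightarrow> M' j = s ! j"
      "\<And>p. p < n \<Longrightarrow> M' (n + p) = lf p" "T + 10 * Suc k \<le> U + 2 + 10 * n" and f': "fixed_regs r'"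
      using 2 k by (auto simp: p_def)
    have bk: "b ! p = s ! k" using b_nth[OF A(2)] last_rotate[OF A(1)] A(3) by simp
    have lfk: "row (lf p) = rotate k s" "lf p < n" using lf_rotate[OF A(2,3)] lf_less[OF A(2)] by auto
    have f'': "fixed_regs (r'(rK := k, rX := s ! k, rAdr := n + p, rP := lf p))"
      by (rule fixed_regs_frame[OF f']) auto
    have inv: "?Inv (r'(rK := k, rX := s ! k, rAdr := n + p, rP := lf p), M'(k := s ! k)) (U - 1 - 1 - 1 - 1 - 2)"
      using f'' lfk A T by (auto simp: le_less)
    then show ?case
      unfolding read_off_step_def using A k T s bk p_def[symmetric] 
      by (intro vcg) (simp_all add: fixed_regsD[OF f'])
  next
    case (3 r' M' U)
    then show ?case by (auto simp: n_def intro!: nth_equalityI)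
  qed
  have "fixed_regs (r(rP := r rRow, rK := n))"
    by (rule fixed_regs_frame[OF f]) auto
  then show ?thesis
    unfolding read_off_def using i T s lfs by (intro vcg loop) (simp_all add: n_def)
qed

lemma queue_Nil: "queue [[]] 0 {}"
  by (auto simp: queue_def)

text \<open>In units of \<open>area * n\<close>: 120 for inserting words, 95 for visiting them and
  32 for the remaining terms, 247 in all.\<close>

lemma time_bound:
  "node_cost * n + n * (visit_cost + 5) + 10 + (10 * n + 12) \<le> 400 * \<sigma> * n ^ 2"
proof -
  have a: "1 \<le> n" "n \<le> area" "\<sigma> \<le> area" "1 \<le> area" using sizes by linarith+
  have an: "400 * \<sigma> * n ^ 2 = 400 * (area * n)" by (simp add: area_def power2_eq_square)
  have "visit_cost + 5 = 30 * area + 50 * \<sigma> + 15" by (simp add: visit_cost_def area_def algebra_simps)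
  then have "visit_cost + 5 \<le> 95 * area" using a by linarith
  then have 1: "n * (visit_cost + 5) \<le> n * (95 * area)" by (rule mult_le_mono2)
  have 2: "node_cost * n = 120 * (area * n)" "n * (95 * area) = 95 * (area * n)"
    by (simp_all add: node_cost_def)
  have "1 * n \<le> area * n" using a by (intro mult_le_mono1)
  then have "n \<le> area * n" "1 \<le> area * n" using a by linarith+
  then show ?thesis using 1 unfolding 2 an by linarith
qed

lemma runs_invert_bwt:
  assumes i: "i < n" "row i = s"
  shows "rn invert_bwt (initial_state [n, \<sigma>, i]) (400 * \<sigma> * n ^ 2) (\<lambda>(r', M') U. map M' [0..<n] = s)"
    (is "rn _ _ ?T ?Q")
proof -
  define X where "X = node_cost * n + n * (visit_cost + 5) + 10"
  define T where "T = ?T"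
  note s = sizes
  have T: "X + (10 * n + 12) \<le> T" using time_bound by (simp add: X_def T_def)
  have "node_cost * 1 \<le> node_cost * n" using s by (intro mult_le_mono2) simp
  then have nX: "node_cost + 10 \<le> X" unfolding X_def by linarith
  define r where "r = fst (initial_state [n, \<sigma>, i])"
  define M where "M = snd (initial_state [n, \<sigma>, i])"
  have r: "r 0 = n" "r (Suc 0) = \<sigma>" "r 2 = i" "\<And>k. 3 \<le> k \<Longrightarrow> r k = 0"
    by (auto simp: r_def initial_state_def)
  let ?S1 = "\<lambda>(r', M') U. U = T - 9 \<and> fixed_regs r' \<and> r' rRow = i \<and> r' rN = 0 \<and> r' rV = 0 \<and> r' rAcc = 0"
  have init_regs: "rn init_regs (r, M) T ?S1"
    unfolding init_regs_def using T r s
    by (intro vcg) (simp_all add: fixed_regs_def area_def[symmetric] numeral_eq_Suc)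
  let ?S2 = "\<lambda>(r', M') U. T \<le> U + 9 + node_cost \<and> r' rRow = i \<and> search_state [[]] 0 {} r' M'"
  have root: "rn new_node (r1, M1) U ?S2" if S1: "?S1 (r1, M1) U" for r1 M1 U
  proof (rule runs_mono[OF runs_new_node[where ws = "[]" and x = "[]"]], goal_cases)
    case (9 r2 M2 V)
    \<comment> \<open>The layout of the root has left the interval starts of one-symbol words in the
      array, which is its required content when only the empty word is known.\<close>
    have "block_start {[]} (lf p) = lo [row (lf p) ! 0]" if "p < n" for p
      using block_start_Nil lf_less that by simp
    moreover have "fixed_regs r2" using fixed_regs_frame[of r1 r2] 9 S1 by simp
    ultimately show ?case
      using 9 S1 queue_Nil lf_less by (auto simp: search_state_def node_cost_def Pre_Nil)
  qed (use S1 T nX s in \<open>auto simp: nodes_def lo_Nil node_cost_def\<close>)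
  let ?S3 = "\<lambda>(r', M') U. fixed_regs r' \<and> r' rRow = i \<and> (\<forall>p<n. M' (n + p) = lf p) \<and> T \<le> U + 9 + X"
  have search: "rn search (r2, M2) U ?S3" if S2: "?S2 (r2, M2) U" for r2 M2 U
    by (rule runs_mono[OF runs_search[folded X_def]]) (use S2 T in auto)
  have read_off: "rn read_off (r3, M3) U ?Q" if S3: "?S3 (r3, M3) U" for r3 M3 U
    by (rule runs_read_off) (use S3 T i in auto)
  have "rn invert_bwt (r, M) T ?Q"
    unfolding invert_bwt_def
    by (rule runs_SeqI[OF init_regs runs_SeqI[OF root runs_SeqI[OF search read_off]]])
  then show ?thesis by (simp add: r_def M_def T_def)
qed

end

theorem theorem8:
  fixes K :: nat
  shows "\<exists>(P :: prog) (Ctime :: nat) (Cspace :: nat).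
    \<forall>(w :: nat) (\<sigma> :: nat) (s :: nat list) (\<pi> :: orderings) (i :: nat).
      \<sigma> \<le> w ^ K \<and> Cspace * \<sigma> * length s \<le> 2 ^ w \<and>
      set s \<subseteq> {..<\<sigma>} \<and> primitive s \<and> orderings_on \<sigma> \<pi> \<and>
      i < length s \<and> ctx_matrix \<pi> s ! i = s \<longrightarrow>
      (\<exists>t \<le> Ctime * \<sigma> * length s ^ 2.
         computes w (Cspace * \<sigma> * length s) (ctx_bwt \<pi> s) \<pi> P [length s, \<sigma>, i] t s)"
proof (rule exI[of _ invert_bwt], rule exI[of _ 400], rule exI[of _ 16], intro allI impI, elim conjE)
  fix w \<sigma> :: nat and s :: "nat list" and \<pi> :: orderings and i :: nat
  assume A: "16 * \<sigma> * length s \<le> 2 ^ w" "set s \<subseteq> {..<\<sigma>}" "primitive s" "orderings_on \<sigma> \<pi>"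
    "i < length s" "ctx_matrix \<pi> s ! i = s"
  interpret C: ctx_bwt_instance \<sigma> s \<pi>
    by unfold_locales (use A in auto)
  interpret ram_instance \<sigma> s \<pi> w
    by unfold_locales (use A in \<open>simp add: C.n_def\<close>)
  \<comment> \<open>\<open>computes\<close> also requires that the output fit into the
    memory.\<close>
  have sg: "length s \<le> 16 * \<sigma> * length s" using sizes by (simp add: mem_def area_def C.n_def)
  have "rn invert_bwt (initial_state [C.n, \<sigma>, i]) (400 * \<sigma> * C.n ^ 2)
      (\<lambda>(r', M') U. map M' [0..<C.n] = s)"
    by (rule runs_invert_bwt) (use A in \<open>auto simp: C.n_def C.row_def\<close>)
  then show "\<exists>t \<le> 400 * \<sigma> * length s ^ 2.
      computes w (16 * \<sigma> * length s) (ctx_bwt \<pi> s) \<pi> invert_bwt [length s, \<sigma>, i] t s"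
    using sg unfolding runs_def computes_def C.b_def mem_def C.n_def by fastforce
qed

end
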